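(* Let $\mathcal G$ be a finite connected compact metric graph with length vector $\ell\in(0,\infty)^{\mathcal E}$, Kirchhoff conditions at interior vertices and a fixed Dirichlet or Neumann condition at each exterior vertex. Let $K\subsetneq\mathcal G$ be a proper primitive subgraph satisfying $\operatorname{RAC}(K,\ell)$, i.e. $H_\ell\cap\mathcal R_K\ne\varnothing$. If $r_\ell=\dim H_\ell\ge2$ and the intrinsic flow of $\ell$ is $(\gamma,\tau)$-Diophantine for some $\gamma>0$ and $\tau>r_\ell-1$, then there exist a constant $C>0$, frequencies $k_n\to\infty$, and eigenfunctions $u_n$ with $\|u_n\|_{L^2(\mathcal G)}=1$ such that for all $n$ $$-\Delta_{\mathcal G,\ell}u_n=k_n^2u_n,\qquad \|u_n\|_{L^2(\mathcal G\setminus K)}^2\le C\,k_n^{-2/\tau}.$$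
   Context: Setting. $\mathcal G=(\mathcal V,\mathcal E,\ell)$: finite connected graph (loops and parallel edges allowed), each edge $e$ identified with $[0,\ell_e]$, $\ell_e>0$. A vertex is exterior if it has degree one (loops count twice), interior otherwise. $L^2(\mathcal G)=\bigoplus_{e}L^2(0,\ell_e)$. $-\Delta_{\mathcal G,\ell}$ is the self-adjoint operator acting as $-u''$ on each edge, on edgewise $H^2$ functions that at each interior vertex are continuous and have vanishing sum of normal derivatives (Kirchhoff), and at each exterior vertex $v$ satisfy the fixed prescribed condition, $u(v)=0$ (Dirichlet) or $\partial_\nu u(v)=0$ (Neumann). A loop is a one-edge simple cycle, and two parallel edges may form a two-edge simple cycle. A primitive subgraph is a simple cycle or a simple path joining two exterior vertices; it is proper if it is not all of $\mathcal G$. Secular objects. $\mathbb T=\mathbb R/2\pi\mathbb Z$. Let $\mathcal B$ be the set of directed bonds (each edge $e$ gives two, $(e,+)$ and $(e,-)$, reverses of each other). Let $S_B$ be the unitary matrix on $\mathbb C^{\mathcal B}$ with $(S_Ba)_b=\sum_{b'}\sigma_{bb'}a_{b'}$, the sum over bonds $b'$ ending at the initial vertex $v$ of $b$; if $v$ is interior of degree $d$, $\sigma_{bb'}=2/d-1$ if $b'$ is the reverse of $b$ and $2/d$ otherwise; if $v$ is exterior, $\sigma_{bb'}=-1$ (Dirichlet) or $+1$ (Neumann). For $\theta\in\mathbb T^{\mathcal E}$, $D(\theta)$ is the diagonal matrix with entry $e^{i\theta_e}$ on both bonds of $e$, and $U_B(\theta)=D(\theta)S_B$. Set $I_e(a)=|a_{e,+}|^2+|a_{e,-}|^2$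 and $Z_B=\{\theta\in\mathbb T^{\mathcal E}:\det(I-U_B(\theta))=0\}$. For a proper primitive $K$, $\mathcal R_K\subset Z_B$ is the set of $\theta$ for which $1$ is a simple eigenvalue of $U_B(\theta)$ and its eigenvector $a$ is supported exactly on $K$ ($I_e(a)>0$ iff $e\subset K$). Arithmetic. $H_\ell=\overline{\{[k\ell]:k\in\mathbb R\}}\subset\mathbb T^{\mathcal E}$, a subtorus of dimension $r_\ell$. Choose a Lie-group isomorphism $\Xi:\mathbb T^{r_\ell}\to H_\ell$ induced by integral lattice coordinates and $\beta\in\mathbb R^{r_\ell}$ with $\Xi([t\beta])=[t\ell]$ for all $t$. With $\widehat\beta=\beta/\|\beta\|$, the intrinsic flow is $(\gamma,\tau)$-Diophantine if $|q\cdot\widehat\beta|\ge\gamma\|q\|^{-\tau}$ for every $q\in\mathbb Z^{r_\ell}\setminus\{0\}$, where $\tau>r_\ell-1$. (Changing the choice of integral coordinates only changes constants, not $\tau$.) *)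

theory Defs
  imports "HOL-Analysis.Analysis"
begin

section \<open>The torus\<close>

definition angle_rel :: "real \<Rightarrow> real \<Rightarrow> bool" where
  "angle_rel x y \<longleftrightarrow> (\<exists>m::int. x - y = 2 * pi * of_int m)"

lemma equivp_angle_rel: "equivp angle_rel"
proof (rule equivpI)
  show "reflp angle_rel"
    by (rule reflpI) (auto simp: angle_rel_def intro: exI[of _ 0])
  show "symp angle_rel"
  proof (rule sympI)
    fix x y assume "angle_rel x y"
    then obtain m :: int where "x - y = 2 * pi * of_int m"
      by (auto simp: angle_rel_def)
    then have "y - x = 2 * pi * of_int (- m)" by simp
    then show "angle_rel y x" unfolding angle_rel_def by blast
  qed
  show "transp angle_rel"
  proof (rule transpI)
    fix x y z assume "angle_rel x y" "angle_rel y z"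
    then obtain m n :: int where "x - y = 2 * pi * of_int m" "y - z = 2 * pi * of_int n"
      by (auto simp: angle_rel_def)
    then have "x - z = 2 * pi * of_int (m + n)" by (simp add: algebra_simps)
    then show "angle_rel x z" unfolding angle_rel_def by blast
  qed
qed

quotient_type angle = real / angle_rel
  by (rule equivp_angle_rel)

lift_definition ang :: "real \<Rightarrow> angle" is "\<lambda>x. x" .

lift_definition cis_angle :: "angle \<Rightarrow> complex" is cis
proof -
  fix x y assume "angle_rel x y"
  then obtain m :: int where "x = y + 2 * pi * of_int m"
    by (auto simp: angle_rel_def algebra_simps)
  then show "cis x = cis y"
    by (simp add: cis_mult[symmetric] cis_multiple_2pi)
qed

instantiation angle :: ab_group_add
begin

lift_definition zero_angle :: angle is "0" .

lift_definition plus_angle :: "angle \<Rightarrow> angle \<Rightarrow> angle" is "(+)"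
proof -
  fix x y x' y' assume "angle_rel x y" "angle_rel x' y'"
  then obtain m n :: int where "x - y = 2 * pi * of_int m" "x' - y' = 2 * pi * of_int n"
    by (auto simp: angle_rel_def)
  then have "(x + x') - (y + y') = 2 * pi * of_int (m + n)" by (simp add: algebra_simps)
  then show "angle_rel (x + x') (y + y')" unfolding angle_rel_def by blast
qed

lift_definition uminus_angle :: "angle \<Rightarrow> angle" is "uminus"
proof -
  fix x y assume "angle_rel x y"
  then obtain m :: int where "x - y = 2 * pi * of_int m"
    by (auto simp: angle_rel_def)
  then have "- x - - y = 2 * pi * of_int (- m)" by simp
  then show "angle_rel (- x) (- y)" unfolding angle_rel_def by blast
qed

definition minus_angle :: "angle \<Rightarrow> angle \<Rightarrow> angle" where
  "minus_angle x y = x + - y"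

instance
proof
  have eq: "angle_rel x y" if "x = y" for x y
    using that equivp_reflp[OF equivp_angle_rel] by simp
  show "a + b + c = a + (b + c)" for a b c :: angle
    by transfer (rule eq, simp)
  show "a + b = b + a" for a b :: angle
    by transfer (rule eq, simp)
  show "0 + a = a" for a :: angle
    by transfer (rule eq, simp)
  show "- a + a = 0" for a :: angle
    by transfer (rule eq, simp)
  show "a - b = a + - b" for a b :: angle
    by (rule minus_angle_def)
qed

end

instantiation angle :: topological_space
begin

definition open_angle :: "angle set \<Rightarrow> bool" where
  "open_angle U \<longleftrightarrow> open (ang -` U)"

instance
proof
  show "open (UNIV :: angle set)" by (simp add: open_angle_def)
  show "open (S \<inter> T)" if "open S" "open T" for S T :: "angle set"
    using that by (auto simp: open_angle_def vimage_Int)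
  show "open (\<Union>K)" if "\<forall>S\<in>K. open S" for K :: "angle set set"
    using that by (auto simp: open_angle_def vimage_Union)
qed

end

definition torus_proj :: "real ^ 'i \<Rightarrow> angle ^ 'i" where
  "torus_proj x = (\<chi> i. ang (x $ i))"


section \<open>Graphs\<close>

datatype boundary_condition = Dirichlet | Neumann

text \<open>Vertices and edges are the elements of (finite) types, so loops and parallel edges are
  allowed. The end of an edge \<open>e\<close> corresponding to \<open>0 \<in> [0, len $ e]\<close> is attached to
  \<open>origin G e\<close>, the other one to \<open>terminus G e\<close>. The value of \<open>bc G\<close> matters only at
  exterior vertices.\<close>

record ('v, 'e) qgraph =
  origin :: "'e \<Rightarrow> 'v"
  terminus :: "'e \<Rightarrow> 'v"
  bc :: "'v \<Rightarrow> boundary_condition"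

text \<open>\<open>(e, True)\<close> is \<open>e\<close> traversed from \<open>0\<close> to \<open>len $ e\<close>; \<open>(e, False)\<close> is its reverse.\<close>

type_synonym 'e bond = "'e \<times> bool"

definition bond_rev :: "'e bond \<Rightarrow> 'e bond" where
  "bond_rev b = (fst b, \<not> snd b)"

definition bond_start :: "('v, 'e) qgraph \<Rightarrow> 'e bond \<Rightarrow> 'v" where
  "bond_start G b = (if snd b then origin G (fst b) else terminus G (fst b))"

definition bond_end :: "('v, 'e) qgraph \<Rightarrow> 'e bond \<Rightarrow> 'v" where
  "bond_end G b = (if snd b then terminus G (fst b) else origin G (fst b))"

text \<open>A loop gives two bonds starting at its vertex, hence counts twice.\<close>

definition degree :: "('v, 'e) qgraph \<Rightarrow> 'v \<Rightarrow> nat" where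
  "degree G v = card {b. bond_start G b = v}"

definition exterior :: "('v, 'e) qgraph \<Rightarrow> 'v \<Rightarrow> bool" where
  "exterior G v \<longleftrightarrow> degree G v = 1"

definition connected_graph :: "('v, 'e) qgraph \<Rightarrow> bool" where
  "connected_graph G \<longleftrightarrow> (\<forall>v w. (v, w) \<in> (range (\<lambda>b. (bond_start G b, bond_end G b)))\<^sup>*)"

definition walk :: "('v, 'e) qgraph \<Rightarrow> 'e bond list \<Rightarrow> bool" where
  "walk G bs \<longleftrightarrow> bs \<noteq> [] \<and> successively (\<lambda>b b'. bond_end G b = bond_start G b') bs"

definition simple_cycle :: "('v, 'e) qgraph \<Rightarrow> 'e bond list \<Rightarrow> bool" where
  "simple_cycle G bs \<longleftrightarrow> walk G bs \<and> bond_end G (last bs) = bond_start G (hd bs) \<and>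
     distinct (map (bond_start G) bs) \<and> distinct (map fst bs)"

definition simple_path :: "('v, 'e) qgraph \<Rightarrow> 'e bond list \<Rightarrow> bool" where
  "simple_path G bs \<longleftrightarrow> walk G bs \<and> distinct (bond_start G (hd bs) # map (bond_end G) bs)"

text \<open>Subgraphs are represented by their sets of edges.\<close>

definition primitive_subgraph :: "('v, 'e) qgraph \<Rightarrow> 'e set \<Rightarrow> bool" where
  "primitive_subgraph G K \<longleftrightarrow> (\<exists>bs. K = fst ` set bs \<and>
     (simple_cycle G bs \<or>
      simple_path G bs \<and> exterior G (bond_start G (hd bs)) \<and> exterior G (bond_end G (last bs))))"


section \<open>The Laplacian\<close>

text \<open>A function on the graph is a family \<open>u\<close> with \<open>u e\<close> considered on \<open>[0, len $ e]\<close>.\<close>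

definition L2_interval :: "real \<Rightarrow> (real \<Rightarrow> complex) \<Rightarrow> bool" where
  "L2_interval L f \<longleftrightarrow> f \<in> borel_measurable (lebesgue_on {0..L}) \<and>
     integrable (lebesgue_on {0..L}) (\<lambda>x. (cmod (f x))\<^sup>2)"

text \<open>\<open>f\<close> is the continuous representative of an element of \<open>H\<^sup>2(0, L)\<close> with derivatives \<open>f1\<close> and
  \<open>f2\<close>: it is differentiable up to the boundary, and \<open>f1\<close> is absolutely continuous with
  a.e. derivative \<open>f2\<close> in \<open>L\<^sup>2\<close>.\<close>

definition H2_interval ::
    "real \<Rightarrow> (real \<Rightarrow> complex) \<Rightarrow> (real \<Rightarrow> complex) \<Rightarrow> (real \<Rightarrow> complex) \<Rightarrow> bool" where
  "H2_interval L f f1 f2 \<longleftrightarrow>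
     (\<forall>x\<in>{0..L}. (f has_vector_derivative f1 x) (at x within {0..L})) \<and>
     (\<forall>x\<in>{0..L}. (f2 has_integral (f1 x - f1 0)) {0..x}) \<and>
     L2_interval L f2"

text \<open>Value, and derivative into the edge, at the initial vertex of a bond.\<close>

definition bond_value ::
    "real ^ 'e \<Rightarrow> ('e \<Rightarrow> real \<Rightarrow> complex) \<Rightarrow> 'e bond \<Rightarrow> complex" where
  "bond_value len u b = (if snd b then u (fst b) 0 else u (fst b) (len $ fst b))"

definition bond_normal_deriv ::
    "real ^ 'e \<Rightarrow> ('e \<Rightarrow> real \<Rightarrow> complex) \<Rightarrow> 'e bond \<Rightarrow> complex" where
  "bond_normal_deriv len u1 b = (if snd b then u1 (fst b) 0 else - u1 (fst b) (len $ fst b))"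

definition vertex_conditions ::
    "('v, 'e) qgraph \<Rightarrow> real ^ 'e \<Rightarrow> ('e \<Rightarrow> real \<Rightarrow> complex) \<Rightarrow> ('e \<Rightarrow> real \<Rightarrow> complex) \<Rightarrow> bool" where
  "vertex_conditions G len u u1 \<longleftrightarrow> (\<forall>v.
     if exterior G v then
       (case bc G v of
          Dirichlet \<Rightarrow> (\<forall>b. bond_start G b = v \<longrightarrow> bond_value len u b = 0)
        | Neumann \<Rightarrow> (\<forall>b. bond_start G b = v \<longrightarrow> bond_normal_deriv len u1 b = 0))
     else
       (\<forall>b b'. bond_start G b = v \<and> bond_start G b' = v \<longrightarrow> bond_value len u b = bond_value len u b') \<and>
       (\<Sum>b | bond_start G b = v. bond_normal_deriv len u1 b) = 0)"

text \<open>\<open>u\<close> is in the domain of the operator, which maps it to \<open>f\<close> (an equality in \<open>L\<^sup>2\<close>).\<close>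

definition neg_laplacian ::
    "('v, 'e) qgraph \<Rightarrow> real ^ 'e \<Rightarrow> ('e \<Rightarrow> real \<Rightarrow> complex) \<Rightarrow> ('e \<Rightarrow> real \<Rightarrow> complex) \<Rightarrow> bool" where
  "neg_laplacian G len u f \<longleftrightarrow> (\<exists>u1 u2.
     (\<forall>e. H2_interval (len $ e) (u e) (u1 e) (u2 e)) \<and>
     vertex_conditions G len u u1 \<and>
     (\<forall>e. AE x in lebesgue_on {0..len $ e}. f e x = - u2 e x))"

definition L2_norm_on :: "real ^ 'e \<Rightarrow> 'e set \<Rightarrow> ('e \<Rightarrow> real \<Rightarrow> complex) \<Rightarrow> real" where
  "L2_norm_on len A u = sqrt (\<Sum>e\<in>A. LINT x|lebesgue_on {0..len $ e}. (cmod (u e x))\<^sup>2)"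


section \<open>Secular objects\<close>

definition scattering_coeff :: "('v, 'e) qgraph \<Rightarrow> 'e bond \<Rightarrow> 'e bond \<Rightarrow> complex" where
  "scattering_coeff G b b' = (let v = bond_start G b; d = degree G v in
     if exterior G v then (case bc G v of Dirichlet \<Rightarrow> -1 | Neumann \<Rightarrow> 1)
     else if b' = bond_rev b then 2 / of_nat d - 1 else 2 / of_nat d)"

definition S_B :: "('v, 'e::finite) qgraph \<Rightarrow> complex ^ 'e bond ^ 'e bond" where
  "S_B G = (\<chi> b b'. if bond_end G b' = bond_start G b then scattering_coeff G b b' else 0)"

definition D_B :: "angle ^ 'e::finite \<Rightarrow> complex ^ 'e bond ^ 'e bond" where
  "D_B \<theta> = (\<chi> b b'. if b = b' then cis_angle (\<theta> $ fst b) else 0)"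

definition U_B :: "('v, 'e::finite) qgraph \<Rightarrow> angle ^ 'e \<Rightarrow> complex ^ 'e bond ^ 'e bond" where
  "U_B G \<theta> = D_B \<theta> ** S_B G"

definition edge_intensity :: "complex ^ 'e::finite bond \<Rightarrow> 'e \<Rightarrow> real" where
  "edge_intensity a e = (cmod (a $ (e, True)))\<^sup>2 + (cmod (a $ (e, False)))\<^sup>2"

definition Z_B :: "('v, 'e::finite) qgraph \<Rightarrow> (angle ^ 'e) set" where
  "Z_B G = {\<theta>. det (mat 1 - U_B G \<theta>) = 0}"

text \<open>As \<open>U_B G \<theta>\<close> is unitary, simplicity of an eigenvalue means that the (complex) dimension of
  its eigenspace is one.\<close>

definition R_K :: "('v, 'e::finite) qgraph \<Rightarrow> 'e set \<Rightarrow> (angle ^ 'e) set" where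
  "R_K G K = {\<theta> \<in> Z_B G.
     vec.dim {a. U_B G \<theta> *v a = a} = 1 \<and>
     (\<exists>a. a \<noteq> 0 \<and> U_B G \<theta> *v a = a \<and> (\<forall>e. edge_intensity a e > 0 \<longleftrightarrow> e \<in> K))}"


section \<open>Arithmetic of the length vector\<close>

definition H_torus :: "real ^ 'e \<Rightarrow> (angle ^ 'e) set" where
  "H_torus len = closure (range (\<lambda>k::real. torus_proj (k *\<^sub>R len)))"

text \<open>The dimension of the closed subgroup \<open>H_torus len\<close>, i.e. that of its Lie algebra.\<close>

definition torus_dim :: "real ^ 'e \<Rightarrow> nat" where
  "torus_dim len = dim {v. \<forall>t::real. torus_proj (t *\<^sub>R v) \<in> H_torus len}"

definition RAC :: "('v, 'e::finite) qgraph \<Rightarrow> 'e set \<Rightarrow> real ^ 'e \<Rightarrow> bool" where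
  "RAC G K len \<longleftrightarrow> H_torus len \<inter> R_K G K \<noteq> {}"

definition real_vec :: "int ^ 'i \<Rightarrow> real ^ 'i" where
  "real_vec q = (\<chi> i. of_int (q $ i))"

text \<open>\<open>\<Xi>\<close> is an isomorphism of Lie groups from the standard torus of dimension \<open>torus_dim len\<close> onto
  \<open>H_torus len\<close>, given in coordinates by an integer matrix \<open>M\<close>, and it carries the linear flow with
  direction \<open>\<beta>\<close> to that with direction \<open>len\<close>.\<close>

definition intrinsic_coordinates ::
    "real ^ 'e \<Rightarrow> (angle ^ 'r \<Rightarrow> angle ^ 'e) \<Rightarrow> real ^ 'r \<Rightarrow> bool" where
  "intrinsic_coordinates len \<Xi> \<beta> \<longleftrightarrow>
     CARD('r) = torus_dim len \<and>
     (\<forall>x y. \<Xi> (x + y) = \<Xi> x + \<Xi> y) \<and>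
     (\<exists>\<Xi>'. homeomorphism UNIV (H_torus len) \<Xi> \<Xi>') \<and>
     (\<exists>M :: int ^ 'r ^ 'e. \<forall>x. \<Xi> (torus_proj x) = torus_proj (\<chi> e. real_vec (M $ e) \<bullet> x)) \<and>
     (\<forall>t::real. \<Xi> (torus_proj (t *\<^sub>R \<beta>)) = torus_proj (t *\<^sub>R len))"

definition diophantine_flow :: "real \<Rightarrow> real \<Rightarrow> real ^ 'r \<Rightarrow> bool" where
  "diophantine_flow \<gamma> \<tau> \<beta> \<longleftrightarrow> (\<forall>q :: int ^ 'r. q \<noteq> 0 \<longrightarrow>
     \<bar>real_vec q \<bullet> (\<beta> /\<^sub>R norm \<beta>)\<bar> \<ge> \<gamma> * norm (real_vec q) powr (- \<tau>))"

end

theory Submission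
  imports Defs
begin

text \<open>Let \<open>v\<close> be the eigenvector supported on \<open>K\<close> at a point \<open>\<theta>\<close> of \<open>H_torus len\<close>. The Diophantine
  condition separates the characters of degree at most \<open>2 n\<close> along the flow by a multiple of
  \<open>n\<close> to the power \<open>- \<tau>\<close>, and a large sieve argument then brings the flow within \<open>O(1 / n)\<close> of \<open>\<theta>\<close>
  at some time \<open>t\<close> of order \<open>n\<close> to the power \<open>\<tau>\<close>. Because the eigenvalue 1 at \<open>\<theta>\<close> is simple and
  increasing the frequency turns all eigenvalues in the same direction, an intermediate value
  argument produces \<open>k = t + O(1 / n)\<close> at which 1 is exactly an eigenvalue, with an eigenvector
  within \<open>O(1 / n)\<close> of \<open>v\<close>. The corresponding eigenfunction has energy \<open>O(1 / n\<^sup>2)\<close> off \<open>K\<close>.\<close>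

section \<open>Visits of a linear flow\<close>

text \<open>The exponent balances two scales. Resolving the torus at scale 1/n takes characters of
  degree n, whose frequencies along the flow are only known to be n^-\<tau> apart, so the waiting
  time is of order n^\<tau>. The amplitude off \<open>K\<close> is then O(1/n), and with k of order
  n^\<tau> its square n^-2 becomes k^(-2/\<tau>). Two obstacles shape the argument. A sharp time
  cutoff leaves denominators equal to frequency differences, and absolute values would then cost a
  logarithm; a triangular cutoff squares them, so crude bounds keep the exact rate. Secondly, the
  flow only comes near the point, whereas an eigenfunction requires the eigenvalue to be exactly 1:
  one complex equation with a single real unknown, the frequency. Unitarity forces the complex
  defect onto a circle through 0, so that its imaginary part decides, and a sign change is
  enough.\<close>

lemma sum_inverse_squares_le:
  assumes "finite S" "0 \<notin> S"
  shows "(\<Sum>k\<in>S. 1 / (real k)\<^sup>2) \<le> 2"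
proof -
  \<comment> \<open>The subtracted \<open>1 / n\<close> lets the induction close: the new term is at
    most \<open>1 / n - 1 / (n + 1)\<close>, so the bound telescopes.\<close>
  have bound: "(\<Sum>k=1..n. 1 / (real k)\<^sup>2) \<le> 2 - 1 / real n" if "n \<ge> 1" for n
    using that
  proof (induction n rule: dec_induct)
    case (step n)
    have "1 / (real (Suc n))\<^sup>2 \<le> 1 / real n - 1 / real (Suc n)"
      using step by (simp add: divide_simps power2_eq_square)
    with step show ?case by simp
  qed simp
  obtain n where n: "\<And>k. k \<in> S \<Longrightarrow> k \<le> n"
    using assms(1) by (auto simp: finite_nat_set_iff_bounded_le)
  have "(\<Sum>k\<in>S. 1 / (real k)\<^sup>2) \<le> (\<Sum>k=1..n. 1 / (real k)\<^sup>2)"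
    using n assms by (intro sum_mono2) (auto simp: Suc_le_eq intro: gr0I)
  also have "\<dots> \<le> 2"
    using bound[of n] by (cases "n = 0") (auto intro: order_trans)
  finally show ?thesis .
qed

text \<open>Rounding \<open>w j / \<eta>\<close> down is injective on \<open>J\<close>, since two
  points in one cell would be closer than \<open>\<eta>\<close>. The sum is therefore dominated by
  inverse squares of distinct positive integers.\<close>

lemma separated_sum_one_sided:
  fixes w :: "'a \<Rightarrow> real"
  assumes "finite J" "\<eta> > 0" "\<And>j. j \<in> J \<Longrightarrow> w j \<ge> \<eta>"
    and sep: "\<And>i j. i \<in> J \<Longrightarrow> j \<in> J \<Longrightarrow> i \<noteq> j \<Longrightarrow> \<bar>w i - w j\<bar> \<ge> \<eta>"
  shows "(\<Sum>j\<in>J. 1 / (w j)\<^sup>2) \<le> 2 / \<eta>\<^sup>2"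
proof -
  define f where "f j = nat \<lfloor>w j / \<eta>\<rfloor>" for j
  have f: "f j \<ge> 1" "real (f j) \<le> w j / \<eta>" "w j / \<eta> < real (f j) + 1" if "j \<in> J" for j
  proof -
    have "w j / \<eta> \<ge> 1" using assms that by (simp add: divide_simps)
    then show "f j \<ge> 1" "real (f j) \<le> w j / \<eta>" "w j / \<eta> < real (f j) + 1"
      unfolding f_def by linarith+
  qed
  have inj: "inj_on f J"
  proof (rule inj_onI, rule ccontr)
    fix i j assume ij: "i \<in> J" "j \<in> J" "f i = f j" "i \<noteq> j"
    then have "\<bar>w i / \<eta> - w j / \<eta>\<bar> < 1" using f[of i] f[of j] by auto
    moreover have "\<bar>w i / \<eta> - w j / \<eta>\<bar> = \<bar>w i - w j\<bar> / \<eta>"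
      using \<open>\<eta> > 0\<close> by (simp add: diff_divide_distrib[symmetric])
    ultimately show False using sep[OF ij(1,2,4)] \<open>\<eta> > 0\<close> by (simp add: divide_simps)
  qed
  have "(\<Sum>j\<in>J. 1 / (w j)\<^sup>2) \<le> (\<Sum>j\<in>J. (1 / (real (f j))\<^sup>2) / \<eta>\<^sup>2)"
  proof (rule sum_mono)
    fix j assume j: "j \<in> J"
    have "real (f j) * \<eta> \<le> w j" "real (f j) * \<eta> > 0"
      using f[OF j] \<open>\<eta> > 0\<close> by (auto simp: field_simps)
    then have "(real (f j) * \<eta>)\<^sup>2 \<le> (w j)\<^sup>2" "(real (f j) * \<eta>)\<^sup>2 > 0"
      by (intro power_mono zero_less_power; linarith)+
    then have "1 / (w j)\<^sup>2 \<le> 1 / (real (f j) * \<eta>)\<^sup>2"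
      by (intro divide_left_mono mult_pos_pos; linarith)
    then show "1 / (w j)\<^sup>2 \<le> (1 / (real (f j))\<^sup>2) / \<eta>\<^sup>2"
      by (simp add: power_mult_distrib)
  qed
  also have "\<dots> = (\<Sum>k\<in>f ` J. 1 / (real k)\<^sup>2) / \<eta>\<^sup>2"
    by (simp add: sum.reindex[OF inj] sum_divide_distrib)
  also have "\<dots> \<le> 2 / \<eta>\<^sup>2"
    using f(1) assms(1) by (intro divide_right_mono sum_inverse_squares_le) force+
  finally show ?thesis .
qed

lemma separated_sum:
  fixes w :: "'a \<Rightarrow> real"
  assumes "finite J" "\<eta> > 0" "\<And>j. j \<in> J \<Longrightarrow> \<bar>w j - x\<bar> \<ge> \<eta>"
    and sep: "\<And>i j. i \<in> J \<Longrightarrow> j \<in> J \<Longrightarrow> i \<noteq> j \<Longrightarrow> \<bar>w i - w j\<bar> \<ge> \<eta>"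
  shows "(\<Sum>j\<in>J. 1 / (w j - x)\<^sup>2) \<le> 4 / \<eta>\<^sup>2"
proof -
  let ?P = "{j\<in>J. w j > x}" and ?N = "{j\<in>J. \<not> w j > x}"
  have "(\<Sum>j\<in>?P. 1 / (w j - x)\<^sup>2) \<le> 2 / \<eta>\<^sup>2"
    using assms(1,2) assms(3) sep
    by (intro separated_sum_one_sided[where w="\<lambda>j. w j - x"]) (force simp: abs_if)+
  moreover have "(\<Sum>j\<in>?N. 1 / (x - w j)\<^sup>2) \<le> 2 / \<eta>\<^sup>2"
    using assms(1,2) assms(3) sep
    by (intro separated_sum_one_sided[where w="\<lambda>j. x - w j"]) (force simp: abs_minus_commute)+
  moreover have "(\<Sum>j\<in>J. 1 / (w j - x)\<^sup>2) = (\<Sum>j\<in>?P. 1 / (w j - x)\<^sup>2) + (\<Sum>j\<in>?N. 1 / (w j - x)\<^sup>2)"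
    using assms(1) by (subst sum.union_disjoint[symmetric]) (auto intro!: sum.cong)
  ultimately show ?thesis by (simp add: power2_commute)
qed

text \<open>The left side is the integral of \<open>h2\<close> against the triangular weight
  \<open>T - |t - m|\<close>. In terms of second antiderivatives, positivity of this weight becomes
  three uses of the mean value theorem, and no integral has to be formed.\<close>

lemma second_difference_nonpos:
  fixes h h1 h2 :: "real \<Rightarrow> real"
  assumes "\<And>t. (h has_real_derivative h1 t) (at t)"
    and "\<And>t. (h1 has_real_derivative h2 t) (at t)"
    and "T > 0" "\<And>t. m - T \<le> t \<Longrightarrow> t \<le> m + T \<Longrightarrow> h2 t \<le> 0"
  shows "h (m + T) - 2 * h m + h (m - T) \<le> 0"
proof -
  obtain s where s: "s > m" "s < m + T" "h (m + T) - h m = T * h1 s"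
    using MVT2[of m "m + T" h h1] assms by auto
  obtain s' where s': "s' > m - T" "s' < m" "h m - h (m - T) = T * h1 s'"
    using MVT2[of "m - T" m h h1] assms by auto
  obtain z where z: "z > s'" "z < s" "h1 s - h1 s' = (s - s') * h2 z"
    using MVT2[of s' s h1 h2] assms s s' by auto
  have "h2 z \<le> 0" using z s s' assms(4) by auto
  then have "h1 s \<le> h1 s'" using z by (smt (verit) mult_nonneg_nonpos)
  then have "T * h1 s \<le> T * h1 s'" using \<open>T > 0\<close> by simp
  with s s' show ?thesis by linarith
qed

text \<open>The second difference of \<open>h\<close> is a mean square under a triangular weight of
  total mass \<open>T^2\<close>, whence the diagonal term. Off the diagonal, integrating twice
  leaves denominators \<open>(w i - w j)^2\<close>, whose row sums are bounded by separation; after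
  a single integration the absolute row sums could grow logarithmically with the number of
  frequencies.\<close>

lemma second_antiderivative_of_trig_square:
  fixes w :: "'a \<Rightarrow> real" and c :: "'a \<Rightarrow> complex"
  assumes I: "finite I" and eta: "\<eta> > 0"
    and sep: "\<And>i j. i \<in> I \<Longrightarrow> j \<in> I \<Longrightarrow> i \<noteq> j \<Longrightarrow> \<bar>w i - w j\<bar> \<ge> \<eta>"
  shows "\<exists>h h1. (\<forall>t. (h has_real_derivative h1 t) (at t)) \<and>
    (\<forall>t. (h1 has_real_derivative (cmod (\<Sum>i\<in>I. c i * cis (w i * t)))\<^sup>2) (at t)) \<and>
    (\<forall>m T. \<bar>h (m + T) - 2 * h m + h (m - T) - T\<^sup>2 * (\<Sum>i\<in>I. (cmod (c i))\<^sup>2)\<bar>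
           \<le> 16 / \<eta>\<^sup>2 * (\<Sum>i\<in>I. (cmod (c i))\<^sup>2))"
proof -
  define E where "E i j t = c i * cnj (c j) * cis ((w i - w j) * t)" for i j t
  define k where "k i j t = (if i = j then (cmod (c i))\<^sup>2 * t\<^sup>2 / 2
    else - Re (E i j t) / (w i - w j)\<^sup>2)" for i j t
  define k1 where "k1 i j t = (if i = j then (cmod (c i))\<^sup>2 * t
    else Im (E i j t) / (w i - w j))" for i j t
  have dE: "(E i j has_vector_derivative (\<i> * (w i - w j)) * E i j t) (at t)" for i j t
  proof -
    have "((\<lambda>z. c i * cnj (c j) * exp (\<i> * (w i - w j) * z)) has_field_derivative
        (\<i> * (w i - w j)) * E i j t) (at (of_real t))"
      unfolding E_def cis_conv_exp by (auto intro!: derivative_eq_intros simp: mult_ac)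
    from has_vector_derivative_real_field[OF this, where s=UNIV] show ?thesis
      by (simp add: E_def[abs_def] cis_conv_exp mult_ac)
  qed
  have dRe: "((\<lambda>t. Re (E i j t)) has_real_derivative Re (\<i> * (w i - w j) * E i j t)) (at t)" for i j t
    using bounded_linear.has_vector_derivative[OF bounded_linear_Re dE]
    by (simp add: has_real_derivative_iff_has_vector_derivative)
  have dIm: "((\<lambda>t. Im (E i j t)) has_real_derivative Im (\<i> * (w i - w j) * E i j t)) (at t)" for i j t
    using bounded_linear.has_vector_derivative[OF bounded_linear_Im dE]
    by (simp add: has_real_derivative_iff_has_vector_derivative)
  have ne: "w i \<noteq> w j" if "i \<in> I" "j \<in> I" "i \<noteq> j" for i j
    using sep[OF that] \<open>\<eta> > 0\<close> by auto
  have dk: "(k i j has_real_derivative k1 i j t) (at t)" if "i \<in> I" "j \<in> I" for i j t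
  proof (cases "i = j")
    case True
    then show ?thesis unfolding k_def k1_def by (auto intro!: derivative_eq_intros)
  next
    case False
    have "((\<lambda>t. - Re (E i j t) / (w i - w j)\<^sup>2) has_real_derivative
           - Re (\<i> * (w i - w j) * E i j t) / (w i - w j)\<^sup>2) (at t)"
      by (intro DERIV_cdivide DERIV_minus dRe)
    then show ?thesis using False ne[OF that False]
      unfolding k_def k1_def by (simp add: power2_eq_square)
  qed
  have dk1: "(k1 i j has_real_derivative Re (E i j t)) (at t)" if "i \<in> I" "j \<in> I" for i j t
  proof (cases "i = j")
    case True
    then show ?thesis unfolding k1_def E_def
      by (auto intro!: derivative_eq_intros simp: complex_mult_cnj cmod_power2)
  next
    case False
    have "((\<lambda>t. Im (E i j t) / (w i - w j)) has_real_derivative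
           Im (\<i> * (w i - w j) * E i j t) / (w i - w j)) (at t)"
      by (intro DERIV_cdivide dIm)
    then show ?thesis using False ne[OF that False]
      unfolding k1_def by simp
  qed
  let ?h = "\<lambda>t. \<Sum>i\<in>I. \<Sum>j\<in>I. k i j t" and ?h1 = "\<lambda>t. \<Sum>i\<in>I. \<Sum>j\<in>I. k1 i j t"
  have sq: "(\<Sum>i\<in>I. \<Sum>j\<in>I. Re (E i j t)) = (cmod (\<Sum>i\<in>I. c i * cis (w i * t)))\<^sup>2" for t
  proof -
    let ?F = "\<Sum>i\<in>I. c i * cis (w i * t)"
    have "complex_of_real ((cmod ?F)\<^sup>2) = ?F * cnj ?F"
      by (rule complex_norm_square)
    also have "\<dots> = (\<Sum>i\<in>I. \<Sum>j\<in>I. E i j t)"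
      by (simp add: sum_product E_def cis_cnj cis_mult algebra_simps)
    finally have "Re (complex_of_real ((cmod ?F)\<^sup>2)) = Re (\<Sum>i\<in>I. \<Sum>j\<in>I. E i j t)"
      by (rule arg_cong)
    then show ?thesis unfolding Re_complex_of_real Re_sum by (rule sym)
  qed
  have sd: "\<bar>?h (m + T) - 2 * ?h m + ?h (m - T) - T\<^sup>2 * (\<Sum>i\<in>I. (cmod (c i))\<^sup>2)\<bar>
           \<le> 16 / \<eta>\<^sup>2 * (\<Sum>i\<in>I. (cmod (c i))\<^sup>2)" for m T
  proof -
    define r where "r i j = (if i = j then 0 else 1 / (w i - w j)\<^sup>2)" for i j
    define d where "d i j = k i j (m + T) - 2 * k i j m + k i j (m - T) -
      (if i = j then T\<^sup>2 * (cmod (c i))\<^sup>2 else 0)" for i j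
    have eq: "?h (m + T) - 2 * ?h m + ?h (m - T) - T\<^sup>2 * (\<Sum>i\<in>I. (cmod (c i))\<^sup>2)
      = (\<Sum>i\<in>I. \<Sum>j\<in>I. d i j)"
      unfolding d_def using I by (simp add: sum.distrib sum_subtractf sum_distrib_left sum.delta)
    \<comment> \<open>Schur's test for the symmetric kernel \<open>r\<close>: splitting
      \<open>4 * p * q\<close> into \<open>2 * p^2 + 2 * q^2\<close> leaves row sums of at most
      \<open>4 / \<eta>^2\<close>, and the two halves together count them four times, which gives
      16.\<close>
    have dle: "\<bar>d i j\<bar> \<le> 2 * ((cmod (c i))\<^sup>2 * r i j) + 2 * ((cmod (c j))\<^sup>2 * r i j)" for i j
    proof (cases "i = j")
      case True
      then show ?thesis by (simp add: d_def k_def r_def power2_eq_square field_simps)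
    next
      case False
      define p where "p = cmod (c i)"
      define q where "q = cmod (c j)"
      have bE: "\<bar>Re (E i j t)\<bar> \<le> p * q" for t
        using abs_Re_le_cmod[of "E i j t"] by (simp add: E_def norm_mult p_def q_def)
      have "d i j = - (Re (E i j (m + T)) - 2 * Re (E i j m) + Re (E i j (m - T))) * r i j"
        using False by (simp add: d_def k_def r_def diff_divide_distrib add_divide_distrib)
      moreover have abs_r: "\<bar>r i j\<bar> = r i j" by (simp add: r_def)
      ultimately have "\<bar>d i j\<bar> = \<bar>Re (E i j (m + T)) - 2 * Re (E i j m) + Re (E i j (m - T))\<bar> * r i j"
        using abs_r by (simp only: abs_mult abs_minus_cancel)
      also have "\<dots> \<le> (4 * (p * q)) * r i j"
        using bE[of "m + T"] bE[of m] bE[of "m - T"] by (intro mult_right_mono) (auto simp: r_def)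
      also have "\<dots> \<le> (2 * p\<^sup>2 + 2 * q\<^sup>2) * r i j"
      proof (rule mult_right_mono)
        show "4 * (p * q) \<le> 2 * p\<^sup>2 + 2 * q\<^sup>2"
          using sum_squares_bound[of p q] unfolding mult.assoc by linarith
      qed (simp add: r_def)
      finally show ?thesis by (simp add: p_def q_def algebra_simps)
    qed
    have rs: "(\<Sum>j\<in>I. r i j) \<le> 4 / \<eta>\<^sup>2" if i: "i \<in> I" for i
    proof -
      have "(\<Sum>j\<in>I. r i j) = r i i + (\<Sum>j\<in>I - {i}. r i j)"
        by (rule sum.remove[OF I i])
      also have "\<dots> = (\<Sum>j\<in>I - {i}. r i j)"
        by (simp add: r_def)
      also have "\<dots> = (\<Sum>j\<in>I - {i}. 1 / (w j - w i)\<^sup>2)"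
      proof (rule sum.cong[OF refl])
        fix j assume "j \<in> I - {i}"
        then show "r i j = 1 / (w j - w i)\<^sup>2"
          unfolding r_def power2_commute[of "w i" "w j"] by auto
      qed
      also have "\<dots> \<le> 4 / \<eta>\<^sup>2"
      proof (rule separated_sum[OF _ eta])
        show "finite (I - {i})" using I by simp
        show "\<bar>w j - w i\<bar> \<ge> \<eta>" if "j \<in> I - {i}" for j
          using sep[of j i] that i by blast
        show "\<bar>w j - w k\<bar> \<ge> \<eta>" if "j \<in> I - {i}" "k \<in> I - {i}" "j \<noteq> k" for j k
          using sep[of j k] that by blast
      qed
      finally show ?thesis .
    qed
    have rc: "r i j = r j i" for i j by (simp add: r_def power2_commute)
    have "\<bar>\<Sum>i\<in>I. \<Sum>j\<in>I. d i j\<bar> \<le> (\<Sum>i\<in>I. \<Sum>j\<in>I. \<bar>d i j\<bar>)"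
      by (rule order_trans[OF sum_abs sum_mono[OF sum_abs]])
    also have "\<dots> \<le> (\<Sum>i\<in>I. \<Sum>j\<in>I. 2 * ((cmod (c i))\<^sup>2 * r i j) + 2 * ((cmod (c j))\<^sup>2 * r i j))"
      by (intro sum_mono dle)
    also have "\<dots> = 2 * (\<Sum>i\<in>I. \<Sum>j\<in>I. (cmod (c i))\<^sup>2 * r i j) + 2 * (\<Sum>i\<in>I. \<Sum>j\<in>I. (cmod (c j))\<^sup>2 * r i j)"
      by (simp add: sum.distrib sum_distrib_left)
    also have "(\<Sum>i\<in>I. \<Sum>j\<in>I. (cmod (c j))\<^sup>2 * r i j) = (\<Sum>i\<in>I. \<Sum>j\<in>I. (cmod (c i))\<^sup>2 * r i j)"
      by (subst sum.swap) (simp add: rc)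
    also have "2 * (\<Sum>i\<in>I. \<Sum>j\<in>I. (cmod (c i))\<^sup>2 * r i j) + 2 * (\<Sum>i\<in>I. \<Sum>j\<in>I. (cmod (c i))\<^sup>2 * r i j)
       = 4 * (\<Sum>i\<in>I. (cmod (c i))\<^sup>2 * (\<Sum>j\<in>I. r i j))"
      by (simp add: sum_distrib_left)
    also have "\<dots> \<le> 4 * (\<Sum>i\<in>I. (cmod (c i))\<^sup>2 * (4 / \<eta>\<^sup>2))"
      by (intro mult_left_mono sum_mono rs) auto
    also have "\<dots> = 16 / \<eta>\<^sup>2 * (\<Sum>i\<in>I. (cmod (c i))\<^sup>2)"
      unfolding sum_distrib_right[symmetric] by simp
    finally show ?thesis unfolding eq .
  qed
  have "(?h has_real_derivative ?h1 t) (at t)" for t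
    by (intro DERIV_sum dk)
  moreover have "(?h1 has_real_derivative (cmod (\<Sum>i\<in>I. c i * cis (w i * t)))\<^sup>2) (at t)" for t
    unfolding sq[symmetric] by (intro DERIV_sum dk1)
  ultimately show ?thesis using sd by (intro exI[of _ ?h] exI[of _ ?h1]) simp
qed

text \<open>A continuous large sieve: over an interval long compared with the inverse gap \<open>1 / \<eta>\<close>, the
  mean squares of all trigonometric polynomials with these frequencies are comparable with the
  \<open>\<ell>\<^sup>2\<close> norms of their coefficients.\<close>

lemma trig_polynomials_dominated_somewhere:
  fixes w :: "'a \<Rightarrow> real" and c :: "'a \<Rightarrow> complex" and d :: "'b \<Rightarrow> 'a \<Rightarrow> complex"
  assumes I: "finite I" and J: "finite J" and eta: "\<eta> > 0" and delta: "\<delta> > 0"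
    and sep: "\<And>i j. i \<in> I \<Longrightarrow> j \<in> I \<Longrightarrow> i \<noteq> j \<Longrightarrow> \<bar>w i - w j\<bar> \<ge> \<eta>"
    and less: "52 * (\<Sum>j\<in>J. \<Sum>i\<in>I. (cmod (d j i))\<^sup>2) < 20 * \<delta> * (\<Sum>i\<in>I. (cmod (c i))\<^sup>2)"
  shows "\<exists>t. \<bar>t - m\<bar> \<le> 6 / \<eta> \<and>
    (\<Sum>j\<in>J. (cmod (\<Sum>i\<in>I. d j i * cis (w i * t)))\<^sup>2) < \<delta> * (cmod (\<Sum>i\<in>I. c i * cis (w i * t)))\<^sup>2"
proof (rule ccontr)
  assume "\<not> ?thesis"
  \<comment> \<open>If the inequality failed on the whole window, this difference and hence its
    triangular mean would be nonpositive, against the comparison of coefficients in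
    \<open>less\<close>.\<close>
  then have neg: "\<delta> * (cmod (\<Sum>i\<in>I. c i * cis (w i * t)))\<^sup>2 -
      (\<Sum>j\<in>J. (cmod (\<Sum>i\<in>I. d j i * cis (w i * t)))\<^sup>2) \<le> 0" if "\<bar>t - m\<bar> \<le> 6 / \<eta>" for t
    using that by force
  define A where "A c h h1 \<longleftrightarrow> (\<forall>t. (h has_real_derivative h1 t) (at t)) \<and>
    (\<forall>t. (h1 has_real_derivative (cmod (\<Sum>i\<in>I. c i * cis (w i * t)))\<^sup>2) (at t)) \<and>
    (\<forall>m T. \<bar>h (m + T) - 2 * h m + h (m - T) - T\<^sup>2 * (\<Sum>i\<in>I. (cmod (c i))\<^sup>2)\<bar>
           \<le> 16 / \<eta>\<^sup>2 * (\<Sum>i\<in>I. (cmod (c i))\<^sup>2))"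
    for c :: "'a \<Rightarrow> complex" and h h1 :: "real \<Rightarrow> real"
  have ex: "\<exists>h h1. A c h h1" for c
    unfolding A_def by (rule second_antiderivative_of_trig_square[OF I eta sep])
  obtain h h1 where "A c h h1" using ex by blast
  then have h:
    "\<And>t. (h has_real_derivative h1 t) (at t)"
    "\<And>t. (h1 has_real_derivative (cmod (\<Sum>i\<in>I. c i * cis (w i * t)))\<^sup>2) (at t)"
    "\<And>m T. \<bar>h (m + T) - 2 * h m + h (m - T) - T\<^sup>2 * (\<Sum>i\<in>I. (cmod (c i))\<^sup>2)\<bar>
           \<le> 16 / \<eta>\<^sup>2 * (\<Sum>i\<in>I. (cmod (c i))\<^sup>2)"
    by (auto simp: A_def)
  have "\<exists>p. \<forall>j. A (d j) (fst (p j)) (snd (p j))"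
    by (intro choice) (use ex in fastforce)
  then obtain p where p: "\<And>j. A (d j) (fst (p j)) (snd (p j))" by blast
  define g where "g j = fst (p j)" for j
  define g1 where "g1 j = snd (p j)" for j
  have "A (d j) (g j) (g1 j)" for j using p by (simp add: g_def g1_def)
  then have g:
    "\<And>j t. (g j has_real_derivative g1 j t) (at t)"
    "\<And>j t. (g1 j has_real_derivative (cmod (\<Sum>i\<in>I. d j i * cis (w i * t)))\<^sup>2) (at t)"
    "\<And>j m T. \<bar>g j (m + T) - 2 * g j m + g j (m - T) - T\<^sup>2 * (\<Sum>i\<in>I. (cmod (d j i))\<^sup>2)\<bar>
           \<le> 16 / \<eta>\<^sup>2 * (\<Sum>i\<in>I. (cmod (d j i))\<^sup>2)"
    by (auto simp: A_def)
  \<comment> \<open>Here \<open>T^2\<close> is 36 / \<eta>^2 while the error is 16 / \<eta>^2, so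
    every triangular mean lies between 20 and 52 times \<open>\<kappa>\<close> times the squared
    norm of the coefficients; these are the constants in \<open>less\<close>.\<close>
  define T where "T = 6 / \<eta>"
  define \<kappa> where "\<kappa> = 1 / \<eta>\<^sup>2"
  have T: "T > 0" "T\<^sup>2 = 36 * \<kappa>" and \<kappa>: "\<kappa> > 0" "16 / \<eta>\<^sup>2 = 16 * \<kappa>"
    using eta by (auto simp: T_def \<kappa>_def power_divide)
  define C where "C = (\<Sum>i\<in>I. (cmod (c i))\<^sup>2)"
  define D where "D j = (\<Sum>i\<in>I. (cmod (d j i))\<^sup>2)" for j
  let ?p = "\<lambda>t. \<delta> * h t - (\<Sum>j\<in>J. g j t)"
  have np: "?p (m + T) - 2 * ?p m + ?p (m - T) \<le> 0"
  proof (rule second_difference_nonpos)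
    show "(?p has_real_derivative \<delta> * h1 t - (\<Sum>j\<in>J. g1 j t)) (at t)" for t
      by (intro DERIV_diff DERIV_cmult DERIV_sum h g)
    show "((\<lambda>t. \<delta> * h1 t - (\<Sum>j\<in>J. g1 j t)) has_real_derivative
      \<delta> * (cmod (\<Sum>i\<in>I. c i * cis (w i * t)))\<^sup>2 -
      (\<Sum>j\<in>J. (cmod (\<Sum>i\<in>I. d j i * cis (w i * t)))\<^sup>2)) (at t)" for t
      by (intro DERIV_diff DERIV_cmult DERIV_sum h g)
  qed (use T neg in \<open>auto simp: T_def abs_le_iff\<close>)
  have "20 * \<kappa> * C \<le> h (m + T) - 2 * h m + h (m - T)"
    using h(3)[of m T] unfolding C_def[symmetric] T \<kappa> abs_le_iff by linarith
  then have a: "\<delta> * (20 * \<kappa> * C) \<le> \<delta> * (h (m + T) - 2 * h m + h (m - T))"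
    using delta by (intro mult_left_mono) auto
  have "g j (m + T) - 2 * g j m + g j (m - T) \<le> 52 * \<kappa> * D j" for j
    using g(3)[of j m T] unfolding D_def[symmetric] T \<kappa> abs_le_iff by linarith
  then have "(\<Sum>j\<in>J. g j (m + T) - 2 * g j m + g j (m - T)) \<le> (\<Sum>j\<in>J. 52 * \<kappa> * D j)"
    by (intro sum_mono)
  then have b: "(\<Sum>j\<in>J. g j (m + T)) - 2 * (\<Sum>j\<in>J. g j m) + (\<Sum>j\<in>J. g j (m - T)) \<le> 52 * \<kappa> * (\<Sum>j\<in>J. D j)"
    by (simp add: sum.distrib sum_subtractf sum_distrib_left)
  have "\<kappa> * (\<delta> * 20 * C) \<le> \<kappa> * (52 * (\<Sum>j\<in>J. D j))"
    using np a b by (simp add: algebra_simps)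
  then have "\<delta> * 20 * C \<le> 52 * (\<Sum>j\<in>J. D j)"
    using \<kappa> by simp
  with less show False by (simp add: C_def D_def)
qed

section \<open>A test polynomial that concentrates at a prescribed point of the torus\<close>

lemma cis_sum: "finite A \<Longrightarrow> cis (sum f A) = (\<Prod>i\<in>A. cis (f i))"
  by (induction A rule: finite_induct) (auto simp: cis_mult[symmetric])

lemma sum_squares_ge_cube: "3 * (\<Sum>k\<le>n. (real k)\<^sup>2) \<ge> (real n) ^ 3"
proof (induction n)
  case (Suc n)
  have "(real (Suc n)) ^ 3 \<le> (real n) ^ 3 + 3 * (real (Suc n))\<^sup>2"
    by (simp add: power2_eq_square power3_eq_cube algebra_simps)
  with Suc show ?case by simp
qed simp

text \<open>The test polynomial is a product of one-variable polynomials with tent coefficients: its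
  smoothness makes multiplication by \<open>1 - cis y\<close> gain a factor \<open>n\<^sup>-\<^sup>2\<close> in the mean square.\<close>

lemma linear_flow_visits:
  fixes \<beta> x :: "real ^ 'r::finite" and n :: nat
  assumes n: "n \<ge> 1" and eta: "\<eta> > 0"
    and sep: "\<And>q :: int ^ 'r. q \<noteq> 0 \<Longrightarrow> (\<And>j. \<bar>q $ j\<bar> \<le> 2 * int n) \<Longrightarrow> \<bar>real_vec q \<bullet> \<beta>\<bar> \<ge> \<eta>"
  shows "\<exists>t. \<bar>t - m\<bar> \<le> 6 / \<eta> \<and>
    (\<Sum>j\<in>UNIV. (cmod (1 - cis (t * \<beta> $ j - x $ j)))\<^sup>2) < 24 * real CARD('r) / (real n)\<^sup>2"
proof -
  \<comment> \<open>Differences of two exponents from this range reach \<open>2 * n\<close> in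
    absolute value, the degree up to which \<open>sep\<close> is assumed.\<close>
  define R where "R = {- int n..int n}"
  define I where "I = (UNIV :: 'r set) \<rightarrow>\<^sub>E R"
  define w where "w g = (\<Sum>i\<in>UNIV. real_of_int (g i) * \<beta> $ i)" for g :: "'r \<Rightarrow> int"
  define a where "a k = max 0 (real n - \<bar>real_of_int k\<bar>)" for k
  define b where "b j i k = (if i = j then a k - a (k - 1) else a k)" for i j :: 'r and k
  define c where "c f g = (\<Prod>i\<in>UNIV. complex_of_real (f i (g i)) * cis (- (real_of_int (g i) * x $ i)))"
    for f :: "'r \<Rightarrow> int \<Rightarrow> real" and g :: "'r \<Rightarrow> int"
  define \<phi> where "\<phi> y = (\<Sum>k\<in>R. complex_of_real (a k) * cis (real_of_int k * y))" for y
  define N where "N = (\<Sum>k\<in>R. (a k)\<^sup>2)"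
  define M where "M = (\<Sum>k\<in>R. (a k - a (k - 1))\<^sup>2)"
  let ?r = "CARD('r)"
  have finR: "finite R" by (simp add: R_def)
  have finI: "finite I" unfolding I_def by (intro finite_PiE) (auto simp: finR)
  have poly: "(\<Sum>g\<in>I. c f g * cis (w g * t)) =
      (\<Prod>i\<in>UNIV. \<Sum>k\<in>R. complex_of_real (f i k) * cis (real_of_int k * (t * \<beta> $ i - x $ i)))" for f t
  proof -
    have "c f g * cis (w g * t) =
      (\<Prod>i\<in>UNIV. complex_of_real (f i (g i)) * cis (real_of_int (g i) * (t * \<beta> $ i - x $ i)))" for g
      unfolding c_def w_def sum_distrib_right cis_sum[OF finite] prod.distrib[symmetric]
      by (intro prod.cong refl) (simp add: mult.assoc cis_mult algebra_simps)
    then show ?thesis unfolding I_def by (simp add: prod_sum_PiE finR)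
  qed
  have coeff: "(\<Sum>g\<in>I. (cmod (c f g))\<^sup>2) = (\<Prod>i\<in>UNIV. \<Sum>k\<in>R. (f i k)\<^sup>2)" for f
  proof -
    have "(cmod (c f g))\<^sup>2 = (\<Prod>i\<in>UNIV. (f i (g i))\<^sup>2)" for g
      unfolding c_def prod_norm[symmetric] norm_mult prod_power_distrib by simp
    then show ?thesis unfolding I_def by (simp add: prod_sum_PiE finR)
  qed
  have tent: "(\<Sum>k\<in>R. complex_of_real (a k - a (k - 1)) * cis (real_of_int k * y)) = (1 - cis y) * \<phi> y" for y
  proof -
    have "cis y * \<phi> y = (\<Sum>k\<in>R. complex_of_real (a (k + 1 - 1)) * cis (real_of_int (k + 1) * y))"
      unfolding \<phi>_def sum_distrib_left
      by (intro sum.cong refl) (simp add: cis_mult algebra_simps)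
    also have "\<dots> = (\<Sum>k\<in>(\<lambda>k. k + 1) ` R. complex_of_real (a (k - 1)) * cis (real_of_int k * y))"
      by (subst sum.reindex) (auto simp: inj_on_def)
    also have "(\<lambda>k. k + 1) ` R = {- int n + 1..int n + 1}"
      unfolding R_def by simp
    \<comment> \<open>The ranges differ only at \<open>k = - n\<close> and \<open>k = n + 1\<close>,
      where the shifted coefficients are \<open>a (- n - 1)\<close> and \<open>a n\<close>. Both are
      0, so the shifted tent still fits into \<open>R\<close>.\<close>
    also have "(\<Sum>k\<in>{- int n + 1..int n + 1}. complex_of_real (a (k - 1)) * cis (real_of_int k * y))
       = (\<Sum>k\<in>{- int n..int n + 1}. complex_of_real (a (k - 1)) * cis (real_of_int k * y))"
      by (rule sum.mono_neutral_left) (auto simp: a_def)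
    also have "\<dots> = (\<Sum>k\<in>R. complex_of_real (a (k - 1)) * cis (real_of_int k * y))"
      unfolding R_def by (rule sum.mono_neutral_right) (auto simp: a_def)
    finally have "cis y * \<phi> y = (\<Sum>k\<in>R. complex_of_real (a (k - 1)) * cis (real_of_int k * y))" .
    then show ?thesis
      unfolding left_diff_distrib by (simp add: \<phi>_def sum_subtractf left_diff_distrib)
  qed
  have shift: "(\<Sum>g\<in>I. c (b j) g * cis (w g * t)) =
     (1 - cis (t * \<beta> $ j - x $ j)) * (\<Sum>g\<in>I. c (\<lambda>_. a) g * cis (w g * t))" for j t
  proof -
    have "(\<Sum>k\<in>R. complex_of_real (b j i k) * cis (real_of_int k * (t * \<beta> $ i - x $ i)))
       = (if i = j then 1 - cis (t * \<beta> $ j - x $ j) else 1) * \<phi> (t * \<beta> $ i - x $ i)" for i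
      unfolding b_def using tent by (auto simp: \<phi>_def)
    then show ?thesis
      unfolding poly \<phi>_def[symmetric] by (simp add: prod.distrib)
  qed
  have N: "N \<ge> (real n) ^ 3 / 3"
  proof -
    have "(\<Sum>k\<le>n. (real k)\<^sup>2) = (\<Sum>k\<in>(\<lambda>k. int n - int k) ` {..n}. (a k)\<^sup>2)"
      by (subst sum.reindex) (auto simp: inj_on_def a_def intro!: sum.cong)
    also have "\<dots> \<le> N"
      unfolding N_def by (rule sum_mono2) (auto simp: R_def)
    finally show ?thesis using sum_squares_ge_cube[of n] by simp
  qed
  then have Npos: "N > 0" using n by (smt (verit) divide_pos_pos of_nat_0_less_iff zero_less_power less_le_trans zero_less_one)
  have M: "M \<le> 3 * real n"
  proof -
    have "M \<le> (\<Sum>k\<in>R. 1)"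
      unfolding M_def
    proof (rule sum_mono)
      fix k
      have "\<bar>a k - a (k - 1)\<bar> \<le> 1" by (auto simp: a_def)
      then show "(a k - a (k - 1))\<^sup>2 \<le> 1" by (simp add: abs_square_le_1)
    qed
    also have "\<dots> \<le> 3 * real n" using n by (simp add: R_def)
    finally show ?thesis .
  qed
  have norm_b: "(\<Sum>g\<in>I. (cmod (c (b j) g))\<^sup>2) = M * N ^ (?r - 1)" for j
  proof -
    have "(\<Sum>k\<in>R. (b j i k)\<^sup>2) = (if i = j then M else N)" for i
      by (simp add: b_def M_def N_def)
    then have "(\<Sum>g\<in>I. (cmod (c (b j) g))\<^sup>2) = (\<Prod>i\<in>UNIV. if i = j then M else N)"
      by (simp add: coeff)
    also have "\<dots> = M * (\<Prod>i\<in>UNIV - {j}. if i = j then M else N)"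
      by (subst prod.remove[of _ j]) auto
    also have "(\<Prod>i\<in>UNIV - {j}. if i = j then M else N) = (\<Prod>i\<in>UNIV - {j}. N)"
      by (rule prod.cong) auto
    finally show ?thesis by (simp add: card_Diff_singleton)
  qed
  have norm_a: "(\<Sum>g\<in>I. (cmod (c (\<lambda>_. a) g))\<^sup>2) = N * N ^ (?r - 1)"
    unfolding coeff N_def[symmetric] by (simp add: power_eq_if)
  have r: "real ?r > 0" by simp
  \<comment> \<open>As \<open>M\<close> is at most \<open>3 * n\<close> and \<open>N\<close> at
    least \<open>n^3 / 3\<close>, the comparison of coefficients amounts to 52 * 3 < 20 * 24 / 3,
    that is 156 < 160; hence the factor 24.\<close>
  define \<delta> where "\<delta> = 24 * real ?r / (real n)\<^sup>2"
  have "\<exists>t. \<bar>t - m\<bar> \<le> 6 / \<eta> \<and>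
    (\<Sum>j\<in>UNIV. (cmod (\<Sum>g\<in>I. c (b j) g * cis (w g * t)))\<^sup>2)
      < \<delta> * (cmod (\<Sum>g\<in>I. c (\<lambda>_. a) g * cis (w g * t)))\<^sup>2"
  proof (rule trig_polynomials_dominated_somewhere[OF finI finite eta])
    show "\<delta> > 0" using n r by (simp add: \<delta>_def)
    show "\<bar>w g - w h\<bar> \<ge> \<eta>" if "g \<in> I" "h \<in> I" "g \<noteq> h" for g h
    proof -
      have "\<bar>real_vec (\<chi> i. g i - h i) \<bullet> \<beta>\<bar> \<ge> \<eta>"
      proof (rule sep)
        show "(\<chi> i. g i - h i) \<noteq> 0" using that(3) by (auto simp: vec_eq_iff)
        have "g j \<in> R" "h j \<in> R" for j using that by (auto simp: I_def)
        note R = this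
        show "\<bar>(\<chi> i. g i - h i) $ j\<bar> \<le> 2 * int n" for j
          using R[of j] by (simp add: R_def abs_le_iff)
      qed
      moreover have "real_vec (\<chi> i. g i - h i) \<bullet> \<beta> = w g - w h"
        by (simp add: real_vec_def inner_vec_def w_def sum_subtractf left_diff_distrib)
      ultimately show ?thesis by simp
    qed
    have "52 * (real ?r * M) < 20 * \<delta> * N"
    proof -
      have "52 * (real ?r * M) \<le> 52 * (real ?r * (3 * real n))"
        using M by (intro mult_left_mono) auto
      also have "\<dots> < 160 * real ?r * real n" using n r by simp
      also have "\<dots> = 20 * \<delta> * ((real n) ^ 3 / 3)"
        using n by (simp add: \<delta>_def power2_eq_square power3_eq_cube)
      also have "\<dots> \<le> 20 * \<delta> * N" using N by (intro mult_left_mono) (auto simp: \<delta>_def)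
      finally show ?thesis .
    qed
    then have "(52 * (real ?r * M)) * N ^ (?r - 1) < (20 * \<delta> * N) * N ^ (?r - 1)"
      using Npos by (intro mult_strict_right_mono) auto
    then show "52 * (\<Sum>j\<in>UNIV. \<Sum>g\<in>I. (cmod (c (b j) g))\<^sup>2) < 20 * \<delta> * (\<Sum>g\<in>I. (cmod (c (\<lambda>_. a) g))\<^sup>2)"
      unfolding norm_a norm_b by (simp add: mult_ac)
  qed
  then obtain t where t: "\<bar>t - m\<bar> \<le> 6 / \<eta>"
    "(\<Sum>j\<in>UNIV. (cmod (\<Sum>g\<in>I. c (b j) g * cis (w g * t)))\<^sup>2)
      < \<delta> * (cmod (\<Sum>g\<in>I. c (\<lambda>_. a) g * cis (w g * t)))\<^sup>2" by blast
  \<comment> \<open>The common factor may be cancelled knowing only that it is nonnegative: a strict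
    inequality excludes that it is 0.\<close>
  have "(\<Sum>j\<in>UNIV. (cmod (1 - cis (t * \<beta> $ j - x $ j)))\<^sup>2) * (cmod (\<Sum>g\<in>I. c (\<lambda>_. a) g * cis (w g * t)))\<^sup>2
     < \<delta> * (cmod (\<Sum>g\<in>I. c (\<lambda>_. a) g * cis (w g * t)))\<^sup>2"
    using t(2) unfolding shift norm_mult power_mult_distrib sum_distrib_right .
  then have "(\<Sum>j\<in>UNIV. (cmod (1 - cis (t * \<beta> $ j - x $ j)))\<^sup>2) < \<delta>"
    by (rule mult_right_less_imp_less) simp
  then show ?thesis using t(1) by (auto simp: \<delta>_def)
qed

section \<open>Perturbation of a simple fixed vector of an isometry\<close>

definition hinner :: "complex ^ 'n::finite \<Rightarrow> complex ^ 'n \<Rightarrow> complex" where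
  "hinner x y = (\<Sum>i\<in>UNIV. cnj (x $ i) * y $ i)"

definition phase :: "complex ^ 'n::finite \<Rightarrow> complex ^ 'n \<Rightarrow> complex ^ 'n" where
  "phase p a = (\<chi> i. p $ i * a $ i)"

lemma norm_vec_sq: "(norm (x :: complex ^ 'n::finite))\<^sup>2 = (\<Sum>i\<in>UNIV. (cmod (x $ i))\<^sup>2)"
  by (simp add: norm_vec_def L2_set_def sum_nonneg)

lemma Re_hinner: "Re (hinner x y) = x \<bullet> y"
  by (simp add: hinner_def inner_vec_def inner_complex_def)

lemma hinner_add_right: "hinner x (y + z) = hinner x y + hinner x z"
  by (simp add: hinner_def algebra_simps sum.distrib)

lemma hinner_diff_right: "hinner x (y - z) = hinner x y - hinner x z"
  by (simp add: hinner_def algebra_simps sum_subtractf)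

lemma hinner_scale_right: "hinner x (c *s y) = c * hinner x y"
  by (simp add: hinner_def sum_distrib_left mult_ac)

lemma Im_hinner: "Im (hinner x y) = x \<bullet> (- \<i> *s y)"
  unfolding Re_hinner[symmetric] hinner_scale_right by simp

lemma hinner_self: "hinner x x = of_real ((norm x)\<^sup>2)"
proof -
  have "cnj (x $ i) * x $ i = of_real ((cmod (x $ i))\<^sup>2)" for i
    unfolding complex_norm_square by (rule mult.commute)
  then show ?thesis by (simp add: hinner_def norm_vec_sq)
qed

lemma norm_hinner_le: "cmod (hinner x y) \<le> norm x * norm y"
proof -
  have "cmod (hinner x y) \<le> (\<Sum>i\<in>UNIV. \<bar>cmod (x $ i)\<bar> * \<bar>cmod (y $ i)\<bar>)"
    unfolding hinner_def by (rule order_trans[OF norm_sum]) (simp add: norm_mult)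
  also have "\<dots> \<le> norm x * norm y"
    unfolding norm_vec_def by (rule L2_set_mult_ineq)
  finally show ?thesis .
qed

lemma norm_scale_vec: "norm (c *s (x :: complex ^ 'n::finite)) = cmod c * norm x"
proof -
  have "(norm (c *s x))\<^sup>2 = (cmod c * norm x)\<^sup>2"
    by (simp add: norm_vec_sq norm_mult power_mult_distrib sum_distrib_left)
  then show ?thesis by simp
qed

text \<open>Polarization recovers the real inner product from the norm. The imaginary part is the
  real inner product of \<open>x\<close> with -i times \<open>y\<close>, and multiplication by -i
  commutes with \<open>M\<close>.\<close>

lemma isometry_preserves_hinner:
  fixes M :: "complex ^ 'n::finite ^ 'n"
  assumes "\<And>a. norm (M *v a) = norm a"
  shows "hinner (M *v x) (M *v y) = hinner x y"
proof -
  have *: "(M *v x) \<bullet> (M *v y) = x \<bullet> y" for x y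
    unfolding dot_norm by (simp add: assms matrix_vector_right_distrib[symmetric])
  show ?thesis
  proof (rule complex_eqI)
    show "Re (hinner (M *v x) (M *v y)) = Re (hinner x y)"
      by (simp only: Re_hinner *)
    show "Im (hinner (M *v x) (M *v y)) = Im (hinner x y)"
      by (simp only: Im_hinner vector_scalar_commute[symmetric] *)
  qed
qed

lemma norm_phase_le:
  assumes "\<And>i. cmod (p $ i) \<le> \<rho>"
  shows "norm (phase p a) \<le> \<rho> * norm a"
proof -
  have r: "\<rho> \<ge> 0" using assms norm_ge_zero order_trans by blast
  have "(norm (phase p a))\<^sup>2 \<le> (\<rho> * norm a)\<^sup>2"
    unfolding power_mult_distrib norm_vec_sq sum_distrib_left
    by (intro sum_mono) (auto simp: phase_def norm_mult power_mult_distrib intro!: mult_right_mono power_mono assms)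
  then show ?thesis by (rule power2_le_imp_le) (simp add: r)
qed

lemma norm_phase_unimodular:
  assumes "\<And>i. cmod (p $ i) = 1"
  shows "norm (phase p a) = norm a"
proof -
  have "(norm (phase p a))\<^sup>2 = (norm a)\<^sup>2"
    unfolding norm_vec_sq by (simp add: phase_def norm_mult assms)
  then show ?thesis by simp
qed

lemma phase_add: "phase p (a + b) = phase p a + phase p b"
  by (simp add: phase_def vec_eq_iff algebra_simps)

lemma phase_scale: "phase p (c *s a) = c *s phase p a"
  by (simp add: phase_def vec_eq_iff algebra_simps)

lemma phase_diff_left: "phase (p - q) a = phase p a - phase q a"
  by (simp add: phase_def vec_eq_iff algebra_simps)

lemma phase_one: "phase 1 a = a"
  by (simp add: phase_def vec_eq_iff)

lemma scaleR_vec_conv: "r *\<^sub>R (x :: complex ^ 'n::finite) = of_real r *s x"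
  unfolding vec_eq_iff vector_scaleR_component vector_smult_component
  by (simp add: scaleR_conv_of_real)

lemma cmod_cis_diff_le: "cmod (cis x - cis y) \<le> \<bar>x - y\<bar>"
proof -
  have "(cmod (cis x - cis y))\<^sup>2 = 2 - 2 * cos (x - y)"
    unfolding cmod_power2 cos_diff using sin_cos_squared_add[of x] sin_cos_squared_add[of y]
    by (simp add: power2_eq_square algebra_simps)
  also have "\<dots> = 4 * (sin ((x - y) / 2))\<^sup>2"
    using cos_double_sin[of "(x - y) / 2"] by (simp only: mult_2 field_sum_of_halves)
  also have "\<dots> \<le> 4 * ((x - y) / 2)\<^sup>2"
    using abs_sin_x_le_abs_x[of "(x - y) / 2"] by (intro mult_left_mono) (simp_all only: abs_le_square_iff)
  also have "\<dots> = \<bar>x - y\<bar>\<^sup>2" by (simp add: power_divide)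
  finally show ?thesis by (rule power2_le_imp_le) simp
qed

lemma sin_diff_self_le: "\<bar>sin x - x\<bar> \<le> x\<^sup>2" for x :: real
proof -
  have "\<bar>sin x - x\<bar> \<le> inverse (fact 2) * \<bar>x\<bar>\<^sup>2"
    using Maclaurin_sin_bound[of x 2] by (simp add: numeral_2_eq_2 sin_coeff_def)
  also have "\<dots> \<le> x\<^sup>2" by simp
  finally show ?thesis .
qed

section \<open>Following the eigenvalue 1 under small changes of the phases\<close>

locale simple_fixed_vector =
  fixes M :: "complex ^ 'n::finite ^ 'n" and v :: "complex ^ 'n"
  assumes isometry: "\<And>a. norm (M *v a) = norm a"
    and norm_v: "norm v = 1" and fixed: "M *v v = v"
    and simple: "\<And>a. M *v a = a \<Longrightarrow> \<exists>c. a = c *s v"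
begin

text \<open>The rank one term makes \<open>L 1\<close> invertible. A solution of \<open>L p a = v\<close> is fixed by \<open>phase p\<close>
  after \<open>M\<close> as soon as the scalar \<open>1 - hinner v a\<close> vanishes.\<close>

definition L :: "complex ^ 'n \<Rightarrow> complex ^ 'n \<Rightarrow> complex ^ 'n" where
  "L p a = a - phase p (M *v a) + hinner v a *s v"

lemma hinner_v_v: "hinner v v = 1"
  by (simp add: hinner_self norm_v)

text \<open>The adjoint of an isometry fixing \<open>v\<close> fixes \<open>v\<close> too, so
  \<open>a - M *v a\<close> has no component along \<open>v\<close>.\<close>

lemma hinner_v_M: "hinner v (M *v a) = hinner v a"
  using isometry_preserves_hinner[OF isometry, of v a] by (simp add: fixed)

lemma linear_L: "linear (L p)"
proof (rule linearI)
  show "L p (x + y) = L p x + L p y" for x y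
    by (simp add: L_def matrix_vector_right_distrib phase_add hinner_add_right vec.scale_left_distrib)
  show "L p (r *\<^sub>R x) = r *\<^sub>R L p x" for r x
    by (simp add: scaleR_vec_conv L_def vector_scalar_commute phase_scale hinner_scale_right
        vec.scale_right_distrib vec.scale_right_diff_distrib)
qed

lemma L_diff: "L p (x - y) = L p x - L p y"
  by (rule linear_diff[OF linear_L])

text \<open>Pairing \<open>L 1 a = 0\<close> with \<open>v\<close> shows that \<open>a\<close> has
  no component along \<open>v\<close>. The rank one term then drops out, so \<open>a\<close> is
  fixed by \<open>M\<close>, and simplicity makes it a multiple of \<open>v\<close>, hence 0. In
  finite dimension injectivity yields a lower bound.\<close>

lemma L_one_bounded_below: "\<exists>B>0. \<forall>a. B * norm a \<le> norm (L 1 a)"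
proof -
  have "a = 0" if "L 1 a = 0" for a
  proof -
    have "hinner v (L 1 a) = hinner v a"
      by (simp add: L_def phase_one hinner_add_right hinner_diff_right hinner_scale_right hinner_v_v hinner_v_M)
    moreover have "hinner v (L 1 a) = 0" unfolding that by (simp add: hinner_def)
    ultimately have h: "hinner v a = 0" by simp
    then have "M *v a = a" using that by (simp add: L_def phase_one)
    then obtain c where c: "a = c *s v" using simple by blast
    with h have "c = 0" by (simp add: hinner_scale_right hinner_v_v)
    with c show ?thesis by simp
  qed
  then have "inj (L 1)"
    using linear_injective_0[OF linear_L] by blast
  then show ?thesis
    using linear_inj_bounded_below_pos[OF linear_L] by (metis mult.commute)
qed

lemma L_perturbed:
  assumes B: "\<And>a. B * norm a \<le> norm (L 1 a)"
    and p: "\<And>i. cmod (p $ i - 1) \<le> B / 2"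
  shows "B / 2 * norm a \<le> norm (L p a)"
proof -
  have "L 1 a - L p a = phase (p - 1) (M *v a)"
    by (simp add: L_def phase_diff_left phase_one)
  then have "norm (L 1 a - L p a) \<le> B / 2 * norm a"
    using norm_phase_le[of "p - 1" "B / 2" "M *v a"] p by (simp add: isometry)
  then show ?thesis using B[of a] norm_triangle_ineq2[of "L 1 a" "L p a"] by (simp add: algebra_simps)
qed

text \<open>For each shift \<open>s\<close> the equation \<open>L p a = v\<close> is solved by some
  \<open>A s\<close>, and the defect \<open>c s\<close> must be made to vanish. It stays on a circle
  through 0, so it suffices that its imaginary part changes sign. It does: all entries of
  \<open>lam\<close> are positive, so a shift by a suitable multiple of \<epsilon> moves every phase
  the same way and outweighs the initial error \<epsilon>.\<close>

lemma perturbation: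
  fixes lam :: "real ^ 'n"
  assumes pos: "\<And>i. lam $ i > 0"
  shows "\<exists>C>0. \<exists>\<epsilon>0>0. \<forall>\<epsilon> w. 0 < \<epsilon> \<and> \<epsilon> \<le> \<epsilon>0 \<and> (\<forall>i. cmod (w $ i) = 1 \<and> cmod (w $ i - 1) \<le> \<epsilon>) \<longrightarrow>
    (\<exists>s a. \<bar>s\<bar> \<le> C * \<epsilon> \<and> norm (a - v) \<le> C * \<epsilon> \<and> phase (\<chi> i. w $ i * cis (s * lam $ i)) (M *v a) = a)"
proof -
  obtain B where B0: "B > 0" and B: "\<And>a. B * norm a \<le> norm (L 1 a)"
    using L_one_bounded_below by blast
  define \<mu> where "\<mu> = Min (range (($) lam))"
  define \<Lambda> where "\<Lambda> = Max (range (($) lam))"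
  have \<mu>: "\<mu> > 0" "\<And>i. lam $ i \<ge> \<mu>" and \<Lambda>: "\<And>i. lam $ i \<le> \<Lambda>"
    unfolding \<mu>_def \<Lambda>_def using pos by auto
  have \<Lambda>0: "\<Lambda> > 0" using \<Lambda> pos less_le_trans by blast
  \<comment> \<open>At \<open>s = \<kappa> * \<epsilon>\<close> the drift \<open>s * lam $ i\<close>
    is at least \<open>2 * \<epsilon>\<close>, twice the initial phase error. Below,
    \<open>R * \<epsilon>\<close> bounds the total deviation of the phases from 1, and
    \<open>Q * \<epsilon>^2\<close> collects all quadratic errors.\<close>
  define \<kappa> where "\<kappa> = 2 / \<mu>"
  have \<kappa>: "\<kappa> > 0" using \<mu> by (simp add: \<kappa>_def)
  define R where "R = 1 + \<kappa> * \<Lambda>"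
  have R: "R > 1" using \<kappa> \<Lambda>0 by (simp add: R_def)
  define Q where "Q = R\<^sup>2 + 2 / B * R\<^sup>2"
  have Q: "Q > 0" using R B0 by (simp add: Q_def add_pos_pos)
  \<comment> \<open>The first bound keeps \<open>L\<close> invertible and the defect at most 1/2;
    the second keeps the quadratic errors below half of the linear term \<epsilon>.\<close>
  define \<epsilon>0 where "\<epsilon>0 = min (B / (4 * R)) (1 / (2 * Q))"
  have \<epsilon>0: "\<epsilon>0 > 0" using B0 R Q by (simp add: \<epsilon>0_def)
  define C where "C = \<kappa> + 2 / B * R"
  have C: "C > 0" "\<kappa> \<le> C" "2 / B * R \<le> C" using \<kappa> B0 R by (auto simp: C_def add_pos_pos)
  have main: "\<exists>s a. \<bar>s\<bar> \<le> C * \<epsilon> \<and> norm (a - v) \<le> C * \<epsilon> \<and> phase (\<chi> i. w $ i * cis (s * lam $ i)) (M *v a) = a"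
    if \<epsilon>: "0 < \<epsilon>" "\<epsilon> \<le> \<epsilon>0" and w: "\<And>i. cmod (w $ i) = 1" "\<And>i. cmod (w $ i - 1) \<le> \<epsilon>" for \<epsilon> w
  proof -
    define J where "J = {- (\<kappa> * \<epsilon>)..\<kappa> * \<epsilon>}"
    define p where "p s = (\<chi> i. w $ i * cis (s * lam $ i))" for s
    define \<rho> where "\<rho> = R * \<epsilon>"
    have "\<epsilon> \<le> B / (4 * R)" "\<epsilon> \<le> 1 / (2 * Q)" using \<epsilon> by (auto simp: \<epsilon>0_def)
    then have \<rho>: "\<rho> \<le> B / 4" and Q\<epsilon>: "Q * \<epsilon> \<le> 1 / 2"
      using R Q by (auto simp: \<rho>_def field_simps)
    have \<rho>0: "\<rho> > 0" using R \<epsilon> by (simp add: \<rho>_def)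
    have pu: "cmod (p s $ i) = 1" for s i by (simp add: p_def norm_mult w)
    have pl: "cmod (p s $ i - p t $ i) \<le> \<Lambda> * \<bar>s - t\<bar>" for s t i
    proof -
      have "cmod (p s $ i - p t $ i) = cmod (cis (s * lam $ i) - cis (t * lam $ i))"
        by (simp add: p_def right_diff_distrib[symmetric] norm_mult w)
      also have "\<dots> \<le> \<bar>s * lam $ i - t * lam $ i\<bar>" by (rule cmod_cis_diff_le)
      also have "\<dots> = lam $ i * \<bar>s - t\<bar>"
        using pos[of i] by (simp add: left_diff_distrib[symmetric] abs_mult)
      also have "\<dots> \<le> \<Lambda> * \<bar>s - t\<bar>" using \<Lambda> by (intro mult_right_mono) auto
      finally show ?thesis .
    qed
    have p1: "cmod (p s $ i - 1) \<le> \<rho>" if "s \<in> J" for s i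
    proof -
      have "cmod (p s $ i - 1) \<le> cmod (p s $ i - p 0 $ i) + cmod (w $ i - 1)"
        using norm_triangle_ineq[of "p s $ i - p 0 $ i" "w $ i - 1"] by (simp add: p_def)
      also have "\<dots> \<le> \<Lambda> * \<bar>s - 0\<bar> + \<epsilon>" by (intro add_mono pl w)
      also have "\<dots> \<le> \<Lambda> * (\<kappa> * \<epsilon>) + \<epsilon>" using that \<Lambda>0 by (auto simp: J_def)
      finally show ?thesis by (simp add: \<rho>_def R_def algebra_simps)
    qed
    have bb: "B / 2 * norm a \<le> norm (L (p s) a)" if "s \<in> J" for s a
    proof (rule L_perturbed[OF B])
      show "cmod (p s $ i - 1) \<le> B / 2" for i
        using p1[OF that, of i] \<rho> B0 by simp
    qed
    have "\<exists>a. L (p s) a = v" if "s \<in> J" for s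
    proof -
      have "x = 0" if "L (p s) x = 0" for x
        using bb[OF \<open>s \<in> J\<close>, of x] that B0 by (simp add: mult_le_0_iff)
      then have "inj (L (p s))" using linear_injective_0[OF linear_L] by blast
      then have "surj (L (p s))" by (intro linear_injective_imp_surjective[OF linear_L] refl)
      then show ?thesis by (metis surjD)
    qed
    then obtain A where A: "\<And>s. s \<in> J \<Longrightarrow> L (p s) (A s) = v" by metis
    define c where "c s = 1 - hinner v (A s)" for s
    have inv_bound: "norm x \<le> 2 / B * norm (L (p s) x)" if "s \<in> J" for s x
      using bb[OF that, of x] B0 by (simp add: field_simps)
    have Av: "norm (A s - v) \<le> 2 / B * \<rho>" if "s \<in> J" for s
    proof -
      have "L (p s) (A s - v) = phase (p s - 1) v"
        using that by (simp add: L_diff A) (simp add: L_def fixed hinner_v_v phase_diff_left phase_one)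
      then have "norm (L (p s) (A s - v)) \<le> \<rho>"
        using norm_phase_le[of "p s - 1" \<rho> v] p1[OF that] by (simp add: norm_v)
      then show ?thesis using inv_bound[OF that, of "A s - v"] B0
        by (smt (verit) divide_pos_pos mult_left_mono)
    qed
    have nA: "norm (A s) \<le> 2 / B" if "s \<in> J" for s
      using inv_bound[OF that, of "A s"] that by (simp add: A norm_v)
    have Alip: "norm (A s - A t) \<le> 2 / B * (\<Lambda> * (2 / B)) * \<bar>s - t\<bar>" if "s \<in> J" "t \<in> J" for s t
    proof -
      have "L (p s) (A s - A t) = L (p t) (A t) - L (p s) (A t)"
        using that by (simp add: L_diff A)
      also have "\<dots> = phase (p s - p t) (M *v A t)"
        by (simp add: L_def phase_diff_left)
      finally have "norm (L (p s) (A s - A t)) \<le> (\<Lambda> * \<bar>s - t\<bar>) * norm (A t)"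
        using norm_phase_le[of "p s - p t" "\<Lambda> * \<bar>s - t\<bar>" "M *v A t"] pl by (simp add: isometry)
      also have "\<dots> \<le> (\<Lambda> * \<bar>s - t\<bar>) * (2 / B)"
        using \<Lambda>0 nA[OF that(2)] by (intro mult_left_mono) auto
      finally have "2 / B * norm (L (p s) (A s - A t)) \<le> 2 / B * ((\<Lambda> * \<bar>s - t\<bar>) * (2 / B))"
        using B0 by (intro mult_left_mono) auto
      then show ?thesis using inv_bound[OF that(1), of "A s - A t"] by (simp add: mult_ac)
    qed
    have "continuous_on J A"
    proof -
      have "(2 / B * (\<Lambda> * (2 / B)))-lipschitz_on J A"
        using Alip B0 \<Lambda>0 by (intro lipschitz_onI) (auto simp: dist_norm)
      then show ?thesis by (rule lipschitz_on_continuous_on)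
    qed
    then have cont: "continuous_on J (\<lambda>s. Im (c s))"
      unfolding c_def hinner_def by (intro continuous_intros)
    have eq: "A s - phase (p s) (M *v A s) = c s *s v" if "s \<in> J" for s
    proof -
      have "A s - phase (p s) (M *v A s) = v - hinner v (A s) *s v"
        using A[OF that] unfolding L_def by (metis add_diff_cancel_right')
      then show ?thesis by (simp add: c_def vec.scale_left_diff_distrib)
    qed
    \<comment> \<open>Subtracting \<open>c s *s v\<close> from \<open>A s\<close> gives a vector of
      the same norm, namely its image under \<open>M\<close> and the phases. With
      \<open>hinner v (A s) = 1 - c s\<close> this is the circle of centre and radius 1/3, whose
      real points are 0 and 2/3.\<close>
    have circle: "3 * (cmod (c s))\<^sup>2 = 2 * Re (c s)" if "s \<in> J" for s
    proof -
      have "norm (A s - c s *s v) = norm (A s)"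
        using norm_phase_unimodular[OF pu, of s "M *v A s"] eq[OF that]
        by (metis add_diff_cancel_left' diff_add_cancel isometry)
      then have "(norm (c s *s v))\<^sup>2 = 2 * ((c s *s v) \<bullet> A s)"
        using dot_norm_neg[of "A s" "c s *s v"] by (simp add: inner_commute)
      moreover have "(c s *s v) \<bullet> A s = Re (cnj (c s) * hinner v (A s))"
        unfolding Re_hinner[symmetric] by (simp add: hinner_def sum_distrib_left mult_ac)
      moreover have "hinner v (A s) = 1 - c s" by (simp add: c_def)
      moreover have "Re (cnj (c s) * (1 - c s)) = Re (c s) - (cmod (c s))\<^sup>2"
        unfolding cmod_power2 by (simp add: power2_eq_square algebra_simps)
      ultimately show ?thesis by (simp add: norm_scale_vec norm_v)
    qed
    \<comment> \<open>This rules out 2/3, the other real point of the circle.\<close>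
    have csmall: "cmod (c s) \<le> 1 / 2" if "s \<in> J" for s
    proof -
      have "c s = hinner v (v - A s)" by (simp add: c_def hinner_diff_right hinner_v_v)
      then have "cmod (c s) \<le> norm (A s - v)"
        using norm_hinner_le[of v "v - A s"] by (simp add: norm_v norm_minus_commute)
      also have "\<dots> \<le> 2 / B * \<rho>" by (rule Av[OF that])
      also have "\<dots> \<le> 2 / B * (B / 4)" using \<rho> B0 by (intro mult_left_mono) auto
      finally show ?thesis using B0 by simp
    qed
    have weight: "(\<Sum>i\<in>UNIV. (cmod (v $ i))\<^sup>2) = 1"
      using norm_v norm_vec_sq[of v] by simp
    \<comment> \<open>Pairing the defect with \<open>v\<close> turns \<open>A s\<close> into
      \<open>M *v A s\<close>, so only the factor \<open>1 - p s\<close> survives; replacing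
      \<open>A s\<close> by \<open>v\<close> then costs second order. To first order,
      \<open>- Im (c s)\<close> is the average of \<open>Im (p s $ i)\<close> with weights
      \<open>(cmod (v $ i))^2\<close>.\<close>
    have expand: "\<bar>Im (c s) + (\<Sum>i\<in>UNIV. (cmod (v $ i))\<^sup>2 * Im (p s $ i))\<bar> \<le> 2 / B * \<rho>\<^sup>2" if "s \<in> J" for s
    proof -
      have "c s = hinner v (A s - phase (p s) (M *v A s))"
        by (simp add: eq[OF that] hinner_scale_right hinner_v_v)
      also have "\<dots> = hinner v (phase (1 - p s) (M *v A s))"
        by (simp add: phase_diff_left phase_one hinner_diff_right hinner_v_M)
      also have "\<dots> = hinner v (phase (1 - p s) v) + hinner v (phase (1 - p s) (M *v (A s - v)))"
        by (simp add: hinner_add_right[symmetric] phase_add[symmetric] matrix_vector_mult_diff_distrib fixed)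
      finally have 1: "c s - hinner v (phase (1 - p s) v) = hinner v (phase (1 - p s) (M *v (A s - v)))"
        by simp
      have "cmod (hinner v (phase (1 - p s) (M *v (A s - v)))) \<le> norm (phase (1 - p s) (M *v (A s - v)))"
        using norm_hinner_le[of v] by (simp add: norm_v)
      also have "\<dots> \<le> \<rho> * norm (M *v (A s - v))"
        using p1[OF that] by (intro norm_phase_le) (simp add: norm_minus_commute)
      also have "\<dots> \<le> \<rho> * (2 / B * \<rho>)"
        unfolding isometry using Av[OF that] \<rho>0 by (intro mult_left_mono) auto
      finally have "cmod (c s - hinner v (phase (1 - p s) v)) \<le> 2 / B * \<rho>\<^sup>2"
        unfolding 1 by (simp add: power2_eq_square mult.left_commute)
      then have "\<bar>Im (c s - hinner v (phase (1 - p s) v))\<bar> \<le> 2 / B * \<rho>\<^sup>2"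
        using abs_Im_le_cmod order_trans by blast
      moreover have "Im (hinner v (phase (1 - p s) v)) = - (\<Sum>i\<in>UNIV. (cmod (v $ i))\<^sup>2 * Im (p s $ i))"
      proof -
        have "cnj (v $ i) * ((1 - p s $ i) * v $ i) = of_real ((cmod (v $ i))\<^sup>2) * (1 - p s $ i)" for i
          unfolding complex_norm_square by (simp add: mult_ac)
        then have "hinner v (phase (1 - p s) v) = (\<Sum>i\<in>UNIV. of_real ((cmod (v $ i))\<^sup>2) * (1 - p s $ i))"
          unfolding hinner_def phase_def
          by (simp only: vec_lambda_beta vector_minus_component one_index)
        then show ?thesis by (simp add: sum_negf[symmetric] del: of_real_power)
      qed
      ultimately show ?thesis by simp
    qed
    have Imp: "\<bar>Im (p s $ i) - s * lam $ i\<bar> \<le> \<epsilon> + (R * \<epsilon>)\<^sup>2" if "s \<in> J" for s i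
    proof -
      let ?x = "s * lam $ i"
      have "Im (p s $ i) - ?x = Im ((w $ i - 1) * cis ?x) + (sin ?x - ?x)"
        by (simp add: p_def algebra_simps)
      moreover have "\<bar>Im ((w $ i - 1) * cis ?x)\<bar> \<le> \<epsilon>"
        using abs_Im_le_cmod[of "(w $ i - 1) * cis ?x"] w(2)[of i] by (simp add: norm_mult)
      ultimately have "\<bar>Im (p s $ i) - ?x\<bar> \<le> \<epsilon> + ?x\<^sup>2"
        using sin_diff_self_le[of ?x] by linarith
      also have "?x\<^sup>2 \<le> (R * \<epsilon>)\<^sup>2"
      proof (rule power2_le_iff_abs_le[THEN iffD2])
        show "0 \<le> R * \<epsilon>" using R \<epsilon> by simp
        have "\<bar>?x\<bar> = \<bar>s\<bar> * lam $ i" using pos[of i] by (simp add: abs_mult)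
        also have "\<dots> \<le> (\<kappa> * \<epsilon>) * \<Lambda>"
          using that \<Lambda>[of i] pos[of i] \<kappa> \<epsilon> by (intro mult_mono) (auto simp: J_def)
        also have "\<dots> \<le> R * \<epsilon>" using \<epsilon> by (simp add: R_def algebra_simps)
        finally show "\<bar>?x\<bar> \<le> R * \<epsilon>" .
      qed
      finally show ?thesis by simp
    qed
    have err: "(R * \<epsilon>)\<^sup>2 + 2 / B * \<rho>\<^sup>2 < \<epsilon>"
    proof -
      have "(R * \<epsilon>)\<^sup>2 + 2 / B * \<rho>\<^sup>2 = (Q * \<epsilon>) * \<epsilon>"
        by (simp add: \<rho>_def Q_def power2_eq_square algebra_simps)
      also have "\<dots> \<le> 1 / 2 * \<epsilon>" using Q\<epsilon> \<epsilon> by (intro mult_right_mono) auto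
      finally show ?thesis using \<epsilon> by simp
    qed
    have ends: "\<kappa> * \<epsilon> \<in> J" "- (\<kappa> * \<epsilon>) \<in> J" using \<kappa> \<epsilon> by (auto simp: J_def)
    have \<kappa>_lam: "2 * \<epsilon> \<le> \<kappa> * \<epsilon> * lam $ i" for i
    proof -
      have "2 = \<kappa> * \<mu>" using \<mu> by (simp add: \<kappa>_def)
      also have "\<dots> \<le> \<kappa> * lam $ i" using \<mu> \<kappa> by simp
      finally show ?thesis using \<epsilon> by (simp add: mult_ac)
    qed
    let ?d = "\<epsilon> - (R * \<epsilon>)\<^sup>2"
    have right: "Im (c (\<kappa> * \<epsilon>)) < 0"
    proof -
      have "?d = (\<Sum>i\<in>UNIV. (cmod (v $ i))\<^sup>2 * ?d)"
        by (simp add: sum_distrib_right[symmetric] weight)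
      also have "\<dots> \<le> (\<Sum>i\<in>UNIV. (cmod (v $ i))\<^sup>2 * Im (p (\<kappa> * \<epsilon>) $ i))"
      proof (intro sum_mono mult_left_mono)
        show "?d \<le> Im (p (\<kappa> * \<epsilon>) $ i)" for i
          using Imp[OF ends(1), of i] \<kappa>_lam[of i] by linarith
      qed simp
      finally show ?thesis using expand[OF ends(1)] err by linarith
    qed
    have left: "Im (c (- (\<kappa> * \<epsilon>))) > 0"
    proof -
      have "- ?d = (\<Sum>i\<in>UNIV. (cmod (v $ i))\<^sup>2 * - ?d)"
        by (simp only: sum_distrib_right[symmetric] weight mult_1)
      also have "\<dots> \<ge> (\<Sum>i\<in>UNIV. (cmod (v $ i))\<^sup>2 * Im (p (- (\<kappa> * \<epsilon>)) $ i))"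
      proof (intro sum_mono mult_left_mono)
        show "Im (p (- (\<kappa> * \<epsilon>)) $ i) \<le> - ?d" for i
          using Imp[OF ends(2), of i] \<kappa>_lam[of i] by (simp add: mult_minus_left)
      qed simp
      finally show ?thesis using expand[OF ends(2)] err by linarith
    qed
    obtain s where s: "- (\<kappa> * \<epsilon>) \<le> s" "s \<le> \<kappa> * \<epsilon>" "Im (c s) = 0"
      using IVT2'[of "\<lambda>s. Im (c s)" "\<kappa> * \<epsilon>" 0 "- (\<kappa> * \<epsilon>)"] left right cont \<kappa> \<epsilon>
      by (auto simp: J_def)
    then have sJ: "s \<in> J" by (simp add: J_def)
    have "c s = 0"
    proof -
      have "(cmod (c s))\<^sup>2 = (Re (c s))\<^sup>2" using s(3) by (simp add: cmod_power2)
      with circle[OF sJ] have "Re (c s) * (3 * Re (c s) - 2) = 0"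
        by (simp add: power2_eq_square algebra_simps)
      moreover have "Re (c s) \<le> 1 / 2"
        using csmall[OF sJ] complex_Re_le_cmod[of "c s"] by linarith
      ultimately have "Re (c s) = 0" by auto
      with s(3) show ?thesis by (simp add: complex_eq_iff)
    qed
    then have "phase (p s) (M *v A s) = A s" using eq[OF sJ] by simp
    moreover have "\<bar>s\<bar> \<le> C * \<epsilon>"
    proof -
      have "\<bar>s\<bar> \<le> \<kappa> * \<epsilon>" using s by simp
      also have "\<dots> \<le> C * \<epsilon>" using C \<epsilon> by simp
      finally show ?thesis .
    qed
    moreover have "norm (A s - v) \<le> C * \<epsilon>"
    proof -
      have "2 / B * \<rho> = (2 / B * R) * \<epsilon>" by (simp add: \<rho>_def)
      also have "\<dots> \<le> C * \<epsilon>" using C \<epsilon> by (intro mult_right_mono) auto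
      finally show ?thesis using Av[OF sJ] by linarith
    qed
    ultimately show ?thesis unfolding p_def by blast
  qed
  show ?thesis
    by (rule exI[of _ C], rule conjI[OF C(1)], rule exI[of _ \<epsilon>0], rule conjI[OF \<epsilon>0], intro allI impI)
      (rule main; simp)
qed

end

section \<open>Bond scattering and eigenfunctions\<close>

lemma bond_rev_bond_rev [simp]: "bond_rev (bond_rev b) = b"
  by (simp add: bond_rev_def)

lemma bij_bond_rev: "bij bond_rev"
  by (rule bijI') (metis bond_rev_bond_rev, metis bond_rev_bond_rev)

lemma bond_rev_eq_iff [simp]: "bond_rev b = bond_rev b' \<longleftrightarrow> b = b'"
  by (metis bond_rev_bond_rev)

lemma bond_end_eq: "bond_end G b = bond_start G (bond_rev b)"
  by (simp add: bond_end_def bond_start_def bond_rev_def)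

text \<open>The bonds arriving at a vertex are the reversals of those leaving it. Reindexing by
  reversal lets every sum at a vertex run over the bonds that start there, as in
  \<open>degree\<close> and \<open>vertex_conditions\<close>.\<close>

lemma S_B_apply:
  fixes G :: "('v, 'e::finite) qgraph"
  shows "(S_B G *v a) $ b =
    (\<Sum>b' | bond_start G b' = bond_start G b. scattering_coeff G b (bond_rev b') * a $ bond_rev b')"
proof -
  have "(S_B G *v a) $ b = (\<Sum>b'\<in>UNIV. if bond_end G b' = bond_start G b then scattering_coeff G b b' * a $ b' else 0)"
    by (auto simp: matrix_vector_mult_def S_B_def intro!: sum.cong)
  also have "\<dots> = (\<Sum>b'\<in>UNIV. if bond_start G b' = bond_start G b
      then scattering_coeff G b (bond_rev b') * a $ bond_rev b' else 0)"
    using sum.reindex_bij_betw[OF bij_bond_rev,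
        of "\<lambda>b'. if bond_end G b' = bond_start G b then scattering_coeff G b b' * a $ b' else 0"]
    by (simp add: bond_end_eq)
  finally show ?thesis by (simp add: sum.If_cases)
qed

lemma S_B_interior:
  fixes G :: "('v, 'e::finite) qgraph"
  assumes "\<not> exterior G (bond_start G b)"
  shows "(S_B G *v a) $ b =
    2 / of_nat (degree G (bond_start G b)) * (\<Sum>b' | bond_start G b' = bond_start G b. a $ bond_rev b')
      - a $ bond_rev b"
proof -
  let ?B = "{b'. bond_start G b' = bond_start G b}" and ?\<alpha> = "2 / of_nat (degree G (bond_start G b)) :: complex"
  have "scattering_coeff G b (bond_rev b') = ?\<alpha> - (if b' = b then 1 else 0)" for b'
    using assms by (simp add: scattering_coeff_def Let_def)
  then have "(S_B G *v a) $ b =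
      (\<Sum>b'\<in>?B. ?\<alpha> * a $ bond_rev b' - (if b' = b then a $ bond_rev b' else 0))"
    unfolding S_B_apply by (intro sum.cong) (auto simp: left_diff_distrib)
  then show ?thesis by (simp add: sum_subtractf sum_distrib_left sum.delta)
qed

lemma bonds_at_exterior:
  assumes "exterior G (bond_start G b)"
  shows "{b'. bond_start G b' = bond_start G b} = {b}"
proof -
  obtain c where c: "{b'. bond_start G b' = bond_start G b} = {c}"
    using assms by (auto simp: exterior_def degree_def card_1_singleton_iff)
  moreover have "b \<in> {b'. bond_start G b' = bond_start G b}" by simp
  ultimately show ?thesis by simp
qed

lemma S_B_exterior:
  fixes G :: "('v, 'e::finite) qgraph"
  assumes "exterior G (bond_start G b)"
  shows "(S_B G *v a) $ b = (case bc G (bond_start G b) of Dirichlet \<Rightarrow> - a $ bond_rev b | Neumann \<Rightarrow> a $ bond_rev b)"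
  using assms
  by (simp add: S_B_apply bonds_at_exterior scattering_coeff_def Let_def split: boundary_condition.split)

text \<open>Up to reversal, scattering at an interior vertex is twice the mean minus the identity,
  which is a reflection; at an exterior vertex it is a sign. The starting vertices partition the
  bonds, so the local identities add up.\<close>

lemma norm_S_B:
  fixes G :: "('v::finite, 'e::finite) qgraph"
  shows "norm (S_B G *v a) = norm a"
proof -
  let ?x = "\<lambda>b. a $ bond_rev b" and ?y = "\<lambda>b. (S_B G *v a) $ b"
  have loc: "(\<Sum>b | bond_start G b = v. (cmod (?y b))\<^sup>2) = (\<Sum>b | bond_start G b = v. (cmod (?x b))\<^sup>2)" for v
  proof (cases "exterior G v")
    case True
    show ?thesis
    proof (rule sum.cong[OF refl])
      fix b assume "b \<in> {b. bond_start G b = v}"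
      then show "(cmod (?y b))\<^sup>2 = (cmod (?x b))\<^sup>2"
        using True by (auto simp: S_B_exterior split: boundary_condition.split)
    qed
  next
    case False
    let ?B = "{b. bond_start G b = v}"
    define \<alpha> where "\<alpha> = 2 / real (degree G v)"
    define X where "X = (\<Sum>b\<in>?B. ?x b)"
    show ?thesis
    \<comment> \<open>An isolated vertex is not exterior and lands here; its sums are empty, whereas
      the computation below cancels the degree.\<close>
    proof (cases "?B = {}")
      case True
      show ?thesis unfolding True by simp
    next
      case nonempty: False
      then have d: "real (degree G v) > 0" unfolding degree_def by (simp add: card_gt_0_iff)
      have y: "?y b = \<alpha> *\<^sub>R X - ?x b" if "b \<in> ?B" for b
        using that False S_B_interior[of G b a] by (simp add: X_def \<alpha>_def scaleR_conv_of_real)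
      have lin: "(\<Sum>b\<in>?B. P - c * f b + g b) = real (card ?B) * P - c * (\<Sum>b\<in>?B. f b) + (\<Sum>b\<in>?B. g b)"
        for P c :: real and f g
        by (simp add: sum.distrib sum_subtractf sum_distrib_left)
      have "(cmod (\<alpha> *\<^sub>R X - z))\<^sup>2 = \<alpha>\<^sup>2 * (X \<bullet> X) - 2 * \<alpha> * (z \<bullet> X) + (cmod z)\<^sup>2" for z
        unfolding power2_norm_eq_inner
        by (simp add: inner_diff_left inner_diff_right inner_commute[of z X] power2_eq_square right_diff_distrib)
      then have "(\<Sum>b\<in>?B. (cmod (?y b))\<^sup>2) = (\<Sum>b\<in>?B. \<alpha>\<^sup>2 * (X \<bullet> X) - 2 * \<alpha> * (?x b \<bullet> X) + (cmod (?x b))\<^sup>2)"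
        by (intro sum.cong refl) (simp only: y)
      also have "\<dots> = real (degree G v) * (\<alpha>\<^sup>2 * (X \<bullet> X)) - 2 * \<alpha> * (\<Sum>b\<in>?B. ?x b \<bullet> X) + (\<Sum>b\<in>?B. (cmod (?x b))\<^sup>2)"
        unfolding degree_def by (rule lin)
      also have "(\<Sum>b\<in>?B. ?x b \<bullet> X) = X \<bullet> X"
        unfolding inner_sum_left[symmetric] X_def[symmetric] ..
      also have "real (degree G v) * (\<alpha>\<^sup>2 * (X \<bullet> X)) = 2 * \<alpha> * (X \<bullet> X)"
        using d by (simp add: \<alpha>_def power2_eq_square)
      finally show ?thesis by simp
    qed
  qed
  have split: "(\<Sum>v\<in>UNIV. \<Sum>b | bond_start G b = v. f b) = (\<Sum>b\<in>UNIV. f b)" for f :: "'e bond \<Rightarrow> real"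
    using sum.group[of "UNIV :: 'e bond set" "UNIV :: 'v set" "bond_start G" f] by simp
  have "(norm (S_B G *v a))\<^sup>2 = (\<Sum>b\<in>UNIV. (cmod (?x b))\<^sup>2)"
    unfolding norm_vec_sq split[symmetric] by (intro sum.cong refl loc)
  also have "\<dots> = (norm a)\<^sup>2"
    unfolding norm_vec_sq using sum.reindex_bij_betw[OF bij_bond_rev, of "\<lambda>b. (cmod (a $ b))\<^sup>2"] by simp
  finally show ?thesis by simp
qed

lemma cis_angle_ang: "cis_angle (ang x) = cis x"
  by transfer simp

lemma U_B_apply: "U_B G \<theta> *v a = phase (\<chi> b. cis_angle (\<theta> $ fst b)) (S_B G *v a)"
proof -
  have "D_B \<theta> *v c = phase (\<chi> b. cis_angle (\<theta> $ fst b)) c" for c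
    by (simp add: vec_eq_iff matrix_vector_mult_def D_B_def phase_def if_distrib[of "\<lambda>x. x * _"] cong: if_cong)
  then show ?thesis by (simp add: U_B_def matrix_vector_mul_assoc[symmetric])
qed

lemma norm_U_B:
  fixes G :: "('v::finite, 'e::finite) qgraph"
  shows "norm (U_B G \<theta> *v a) = norm a"
proof -
  have "cmod (cis_angle t) = 1" for t by transfer simp
  then show ?thesis by (simp add: U_B_apply norm_phase_unimodular norm_S_B)
qed

section \<open>Intensities and plane waves on the edges\<close>

lemma sum_bonds: "(\<Sum>b\<in>UNIV. f b) = (\<Sum>e\<in>UNIV. f (e, True) + f (e, False))"
  for f :: "'e::finite bond \<Rightarrow> real"
proof -
  have "(\<Sum>b\<in>UNIV. f b) = (\<Sum>b\<in>UNIV \<times> UNIV. f b)" by simp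
  also have "\<dots> = (\<Sum>e\<in>UNIV. \<Sum>s\<in>UNIV. f (e, s))" by (rule sum.cartesian_product')
  finally show ?thesis by (simp add: UNIV_bool add.commute)
qed

lemma sum_edge_intensity: "(\<Sum>e\<in>UNIV. edge_intensity a e) = (norm a)\<^sup>2"
  by (simp add: norm_vec_sq sum_bonds edge_intensity_def)

text \<open>As \<open>U_B\<close> scatters first and applies the edge phase afterwards,
  \<open>a $ b\<close> is the amplitude of the wave along \<open>b\<close> when it arrives at the
  end of \<open>b\<close>. Hence the phase is normalized at \<open>len $ e\<close> for
  \<open>(e, True)\<close> and at 0 for \<open>(e, False)\<close>.\<close>

definition edge_wave :: "real ^ 'e \<Rightarrow> real \<Rightarrow> complex ^ 'e::finite bond \<Rightarrow> 'e \<Rightarrow> real \<Rightarrow> complex" where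
  "edge_wave len k a e x = a $ (e, True) * cis (k * (x - len $ e)) + a $ (e, False) * cis (- (k * x))"

definition edge_wave_deriv :: "real ^ 'e \<Rightarrow> real \<Rightarrow> complex ^ 'e::finite bond \<Rightarrow> 'e \<Rightarrow> real \<Rightarrow> complex" where
  "edge_wave_deriv len k a e x =
    \<i> * k * (a $ (e, True) * cis (k * (x - len $ e)) - a $ (e, False) * cis (- (k * x)))"

lemma has_vector_derivative_cis:
  "((\<lambda>x. cis (c * x + d)) has_vector_derivative \<i> * c * cis (c * x + d)) (at x within S)"
proof -
  have "((\<lambda>z. exp (\<i> * (c * z + d))) has_field_derivative \<i> * c * cis (c * x + d)) (at (of_real x))"
    unfolding cis_conv_exp by (auto intro!: derivative_eq_intros simp: mult_ac)
  from has_vector_derivative_real_field[OF this, where s=S] show ?thesis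
    by (simp add: cis_conv_exp)
qed

lemma has_vector_derivative_edge_wave:
  "(edge_wave len k a e has_vector_derivative edge_wave_deriv len k a e x) (at x within S)"
proof -
  have "((\<lambda>x. a $ (e, True) * cis (k * x + - (k * len $ e)) + a $ (e, False) * cis (- k * x + 0))
      has_vector_derivative a $ (e, True) * (\<i> * k * cis (k * x + - (k * len $ e)))
        + a $ (e, False) * (\<i> * (- k) * cis (- k * x + 0))) (at x within S)"
    using has_vector_derivative_cis[of k "- (k * len $ e)" x S] has_vector_derivative_cis[of "- k" 0 x S]
    by (intro has_vector_derivative_add has_vector_derivative_mult_right) auto
  then show ?thesis
    by (simp add: edge_wave_def[abs_def] edge_wave_deriv_def algebra_simps)
qed

lemma has_vector_derivative_edge_wave_deriv:
  "(edge_wave_deriv len k a e has_vector_derivative - of_real (k\<^sup>2) * edge_wave len k a e x) (at x within S)"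
proof -
  have "((\<lambda>x. \<i> * k * (a $ (e, True) * cis (k * x + - (k * len $ e)) - a $ (e, False) * cis (- k * x + 0)))
      has_vector_derivative \<i> * k * (a $ (e, True) * (\<i> * k * cis (k * x + - (k * len $ e)))
        - a $ (e, False) * (\<i> * of_real (- k) * cis (- k * x + 0)))) (at x within S)"
    by (intro has_vector_derivative_diff has_vector_derivative_mult_right has_vector_derivative_cis)
  then have "(edge_wave_deriv len k a e has_vector_derivative
      \<i> * k * (a $ (e, True) * (\<i> * k * cis (k * x + - (k * len $ e)))
        - a $ (e, False) * (\<i> * of_real (- k) * cis (- k * x + 0)))) (at x within S)"
    by (simp add: edge_wave_deriv_def[abs_def] right_diff_distrib)
  then show ?thesis
    by (rule has_vector_derivative_eq_rhs) (simp add: edge_wave_def algebra_simps power2_eq_square)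
qed

lemma continuous_on_edge_wave: "continuous_on S (edge_wave len k a e)"
  by (rule continuous_on_vector_derivative[OF has_vector_derivative_edge_wave])

lemma edge_wave_neg_laplacian:
  fixes G :: "('v::finite, 'e::finite) qgraph"
  assumes len: "\<forall>e. len $ e > 0"
    and fixed: "U_B G (torus_proj (k *\<^sub>R len)) *v a = a"
  shows "neg_laplacian G len (edge_wave len k a) (\<lambda>e x. of_real (k\<^sup>2) * edge_wave len k a e x)"
  unfolding neg_laplacian_def
proof (intro exI conjI allI)
  let ?u = "edge_wave len k a" and ?u1 = "edge_wave_deriv len k a"
  let ?u2 = "\<lambda>e x. - of_real (k\<^sup>2) * edge_wave len k a e x"
  show "H2_interval (len $ e) (?u e) (?u1 e) (?u2 e)" for e
    unfolding H2_interval_def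
  proof (intro conjI ballI)
    show "(?u e has_vector_derivative ?u1 e x) (at x within {0..len $ e})" for x
      by (rule has_vector_derivative_edge_wave)
    show "(?u2 e has_integral (?u1 e x - ?u1 e 0)) {0..x}" if "x \<in> {0..len $ e}" for x
      using that by (intro fundamental_theorem_of_calculus has_vector_derivative_edge_wave_deriv) auto
    have c: "continuous_on {0..len $ e} (?u2 e)"
      by (intro continuous_intros continuous_on_edge_wave)
    show "L2_interval (len $ e) (?u2 e)"
      unfolding L2_interval_def
    proof
      show "?u2 e \<in> borel_measurable (lebesgue_on {0..len $ e})"
        by (rule continuous_imp_measurable_on_sets_lebesgue[OF c]) simp
      show "integrable (lebesgue_on {0..len $ e}) (\<lambda>x. (cmod (?u2 e x))\<^sup>2)"
        by (intro continuous_imp_integrable_real continuous_intros c)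
    qed
  qed
  have ab: "a $ b = cis (k * len $ fst b) * (S_B G *v a) $ b" for b
  proof -
    have "a $ b = (U_B G (torus_proj (k *\<^sub>R len)) *v a) $ b" using fixed by simp
    then show ?thesis by (simp add: U_B_apply phase_def torus_proj_def cis_angle_ang)
  qed
  have outgoing: "a $ b * cis (- (k * len $ fst b)) = (S_B G *v a) $ b" for b
  proof -
    have "a $ b * cis (- (k * len $ fst b)) = cis (k * len $ fst b) * cis (- (k * len $ fst b)) * (S_B G *v a) $ b"
      by (subst ab) (simp only: mult_ac)
    then show ?thesis by (simp add: cis_mult)
  qed
  \<comment> \<open>At the start of \<open>b\<close> the departing wave has amplitude
    \<open>(S_B G *v a) $ b\<close> and the arriving one \<open>a $ bond_rev b\<close>: values add
    them, derivatives into the edge subtract them. At an interior vertex the sum is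
    \<open>2 / degree\<close> times the total arriving amplitude, the same for all bonds.\<close>
  have val: "bond_value len ?u b = (S_B G *v a) $ b + a $ bond_rev b" for b
  proof (cases b)
    case (Pair e s)
    then show ?thesis
      using outgoing[of b] by (cases s) (simp_all add: bond_value_def edge_wave_def bond_rev_def)
  qed
  have der: "bond_normal_deriv len ?u1 b = \<i> * k * ((S_B G *v a) $ b - a $ bond_rev b)" for b
  proof (cases b)
    case (Pair e s)
    then show ?thesis
      using outgoing[of b] by (cases s) (simp_all add: bond_normal_deriv_def edge_wave_deriv_def bond_rev_def algebra_simps)
  qed
  show "vertex_conditions G len ?u ?u1"
    unfolding vertex_conditions_def
  proof
    fix v
    show "if exterior G v then
       (case bc G v of
          Dirichlet \<Rightarrow> (\<forall>b. bond_start G b = v \<longrightarrow> bond_value len ?u b = 0)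
        | Neumann \<Rightarrow> (\<forall>b. bond_start G b = v \<longrightarrow> bond_normal_deriv len ?u1 b = 0))
     else
       (\<forall>b b'. bond_start G b = v \<and> bond_start G b' = v \<longrightarrow> bond_value len ?u b = bond_value len ?u b') \<and>
       (\<Sum>b | bond_start G b = v. bond_normal_deriv len ?u1 b) = 0"
    proof (cases "exterior G v")
      case True
      then show ?thesis
        by (auto simp: val der S_B_exterior split: boundary_condition.split)
    next
      case False
      let ?B = "{b. bond_start G b = v}"
      define X where "X = (\<Sum>b\<in>?B. a $ bond_rev b)"
      have y: "(S_B G *v a) $ b = 2 / of_nat (degree G v) * X - a $ bond_rev b" if "b \<in> ?B" for b
        using that False S_B_interior[of G b a] by (simp add: X_def)
      have "(\<Sum>b\<in>?B. bond_normal_deriv len ?u1 b) = (\<Sum>b\<in>?B. \<i> * k * (2 / of_nat (degree G v) * X - 2 * a $ bond_rev b))"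
        by (intro sum.cong refl) (simp add: der y)
      also have "\<dots> = \<i> * k * (of_nat (degree G v) * (2 / of_nat (degree G v) * X) - 2 * X)"
        by (simp only: sum_distrib_left[symmetric] sum_subtractf X_def[symmetric] sum_constant degree_def[symmetric])
          (simp only: mult_ac)
      also have "\<dots> = 0"
      proof (cases "degree G v = 0")
        case True
        then have B: "?B = {}" by (simp add: degree_def)
        show ?thesis unfolding X_def B by simp
      qed simp
      finally show ?thesis using False by (simp add: val y)
    qed
  qed
  show "AE x in lebesgue_on {0..len $ e}. of_real (k\<^sup>2) * ?u e x = - ?u2 e x" for e
    by simp
qed

text \<open>The two opposite waves interfere with spatial frequency \<open>2 * k\<close>. The cross
  term has an explicit antiderivative of size at most \<open>edge_intensity a e / (2 * k)\<close>,
  evaluated at two endpoints.\<close>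

lemma edge_wave_norm:
  assumes len: "len $ e > 0" and k: "k > 0"
  shows "\<bar>(LINT x|lebesgue_on {0..len $ e}. (cmod (edge_wave len k a e x))\<^sup>2) - len $ e * edge_intensity a e\<bar>
    \<le> edge_intensity a e / k"
proof -
  define p where "p = a $ (e, True)"
  define q where "q = a $ (e, False)"
  let ?l = "len $ e" and ?I = "edge_intensity a e"
  define F where "F x = ?I * x + Im (p * cnj q * cis (k * (2 * x - ?l))) / k" for x
  have sq: "(cmod (edge_wave len k a e x))\<^sup>2 = ?I + 2 * Re (p * cnj q * cis (k * (2 * x - ?l)))" for x
  proof -
    have "cis (k * (2 * x - ?l)) = cis (k * (x - ?l)) * cnj (cis (- (k * x)))"
      by (simp add: cis_cnj cis_mult algebra_simps)
    then have cross: "(p * cis (k * (x - ?l))) * cnj (q * cis (- (k * x))) = p * cnj q * cis (k * (2 * x - ?l))"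
      by (simp add: mult_ac)
    have "(cmod (z + w))\<^sup>2 = (cmod z)\<^sup>2 + (cmod w)\<^sup>2 + 2 * Re (z * cnj w)" for z w
      unfolding cmod_power2 by (simp add: power2_eq_square algebra_simps)
    from this[of "p * cis (k * (x - ?l))" "q * cis (- (k * x))"] show ?thesis
      unfolding cross norm_mult norm_cis mult_1_right edge_wave_def edge_intensity_def
        p_def[symmetric] q_def[symmetric] .
  qed
  have "((\<lambda>x. (cmod (edge_wave len k a e x))\<^sup>2) has_integral (F ?l - F 0)) {0..?l}"
  proof (rule fundamental_theorem_of_calculus)
    fix x assume "x \<in> {0..?l}"
    have "((\<lambda>x. p * cnj q * cis (2 * k * x + - (k * ?l))) has_vector_derivative
        p * cnj q * (\<i> * of_real (2 * k) * cis (2 * k * x + - (k * ?l)))) (at x within {0..?l})"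
      by (intro has_vector_derivative_mult_right has_vector_derivative_cis)
    from bounded_linear.has_vector_derivative[OF bounded_linear_Im this]
    have "((\<lambda>x. Im (p * cnj q * cis (k * (2 * x - ?l)))) has_real_derivative
        2 * k * Re (p * cnj q * cis (k * (2 * x - ?l)))) (at x within {0..?l})"
      unfolding has_real_derivative_iff_has_vector_derivative
      by (simp add: algebra_simps)
    then have "(F has_real_derivative ?I * 1 + (2 * k * Re (p * cnj q * cis (k * (2 * x - ?l)))) / k) (at x within {0..?l})"
      unfolding F_def by (intro DERIV_add DERIV_cmult DERIV_ident DERIV_cdivide)
    then show "(F has_vector_derivative (cmod (edge_wave len k a e x))\<^sup>2) (at x within {0..?l})"
      using k unfolding sq has_real_derivative_iff_has_vector_derivative by (simp del: times_complex.sel)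
  qed (use len in simp)
  moreover have "integrable (lebesgue_on {0..?l}) (\<lambda>x. (cmod (edge_wave len k a e x))\<^sup>2)"
    by (intro continuous_imp_integrable_real continuous_intros continuous_on_edge_wave)
  ultimately have "(LINT x|lebesgue_on {0..?l}. (cmod (edge_wave len k a e x))\<^sup>2) = F ?l - F 0"
    by (simp add: lebesgue_integral_eq_integral integral_unique)
  moreover have bound: "\<bar>Im (p * cnj q * cis y)\<bar> \<le> ?I / 2" for y
  proof -
    have "\<bar>Im (p * cnj q * cis y)\<bar> \<le> cmod p * cmod q"
      using abs_Im_le_cmod[of "p * cnj q * cis y"] by (simp add: norm_mult)
    also have "\<dots> \<le> ?I / 2"
      using sum_squares_bound[of "cmod p" "cmod q"] by (simp add: edge_intensity_def p_def q_def)
    finally show ?thesis .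
  qed
  have "\<bar>Im (p * cnj q * cis (k * (2 * ?l - ?l))) - Im (p * cnj q * cis (k * (2 * 0 - ?l)))\<bar> \<le> ?I"
    using bound[of "k * (2 * ?l - ?l)"] bound[of "k * (2 * 0 - ?l)"] by linarith
  then have "\<bar>Im (p * cnj q * cis (k * (2 * ?l - ?l))) - Im (p * cnj q * cis (k * (2 * 0 - ?l)))\<bar> / k \<le> ?I / k"
    using k by (intro divide_right_mono) auto
  ultimately show ?thesis
    using k by (simp add: F_def diff_divide_distrib[symmetric] mult.commute)
qed

section \<open>Resonant frequencies\<close>

lemma cmod_one_minus_cis_uminus: "cmod (1 - cis (- y)) = cmod (1 - cis y)"
  using complex_mod_cnj[of "1 - cis y"] by (simp add: cis_cnj)

lemma cmod_one_minus_cis_add: "cmod (1 - cis (x + y)) \<le> cmod (1 - cis x) + cmod (1 - cis y)"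
proof -
  have eq: "1 - cis (x + y) = (1 - cis x) + cis x * (1 - cis y)"
    by (simp add: cis_mult[symmetric] algebra_simps)
  have "cmod (1 - cis (x + y)) \<le> cmod (1 - cis x) + cmod (cis x * (1 - cis y))"
    unfolding eq by (rule norm_triangle_ineq)
  then show ?thesis by (simp add: norm_mult)
qed

lemma cmod_one_minus_cis_sum: "cmod (1 - cis (\<Sum>j\<in>A. f j)) \<le> (\<Sum>j\<in>A. cmod (1 - cis (f j)))"
proof (induction A rule: infinite_finite_induct)
  case (insert a A)
  then show ?case using cmod_one_minus_cis_add[of "f a" "\<Sum>j\<in>A. f j"] by simp
qed auto

lemma cmod_one_minus_cis_of_int: "cmod (1 - cis (of_int m * y)) \<le> \<bar>of_int m\<bar> * cmod (1 - cis y)"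
proof -
  have nat: "cmod (1 - cis (of_nat n * y)) \<le> of_nat n * cmod (1 - cis y)" for n :: nat and y
  proof (induction n)
    case (Suc n)
    then show ?case using cmod_one_minus_cis_add[of y "of_nat n * y"] by (simp add: algebra_simps)
  qed simp
  show ?thesis
  proof (cases m)
    case (nonneg n)
    then show ?thesis using nat[of n y] by simp
  next
    case (neg n)
    have "of_int m * y = - (of_nat (Suc n) * y)" "\<bar>of_int m\<bar> = (of_nat (Suc n) :: real)"
      unfolding neg by (simp_all add: algebra_simps)
    then show ?thesis using nat[of "Suc n" y] by (simp only: cmod_one_minus_cis_uminus)
  qed
qed

text \<open>Measuring angles by \<open>cmod (1 - cis y)\<close> avoids choosing representatives
  modulo \<open>2 * pi\<close>: the quantity is subadditive, and an integer multiple enlarges it at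
  most by that integer.\<close>

lemma cis_character_lipschitz:
  fixes q :: "int ^ 'r::finite"
  assumes "\<And>j. cmod (1 - cis (x $ j - y $ j)) \<le> \<delta>"
  shows "cmod (cis (real_vec q \<bullet> x) - cis (real_vec q \<bullet> y)) \<le> (\<Sum>j\<in>UNIV. \<bar>of_int (q $ j)\<bar>) * \<delta>"
proof -
  have "cis (real_vec q \<bullet> x) - cis (real_vec q \<bullet> y) = - cis (real_vec q \<bullet> y) * (1 - cis (real_vec q \<bullet> (x - y)))"
    by (simp add: right_diff_distrib cis_mult inner_diff_right)
  then have "cmod (cis (real_vec q \<bullet> x) - cis (real_vec q \<bullet> y)) = cmod (1 - cis (\<Sum>j\<in>UNIV. of_int (q $ j) * (x $ j - y $ j)))"
    by (simp add: norm_mult inner_vec_def real_vec_def)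
  also have "\<dots> \<le> (\<Sum>j\<in>UNIV. cmod (1 - cis (of_int (q $ j) * (x $ j - y $ j))))"
    by (rule cmod_one_minus_cis_sum)
  also have "\<dots> \<le> (\<Sum>j\<in>UNIV. \<bar>of_int (q $ j)\<bar> * \<delta>)"
    by (intro sum_mono order_trans[OF cmod_one_minus_cis_of_int] mult_left_mono assms) auto
  finally show ?thesis by (simp add: sum_distrib_right)
qed

section \<open>Approaching a point of \<open>H_torus\<close> along the flow\<close>

lemma torus_proj_surj: "\<exists>x. torus_proj x = \<theta>"
proof -
  have "\<exists>y. ang y = t" for t by transfer (auto intro: equivp_reflp[OF equivp_angle_rel])
  then obtain f where "\<And>t. ang (f t) = t" by metis
  then have "torus_proj (\<chi> i. f (\<theta> $ i)) = \<theta>" by (simp add: torus_proj_def vec_eq_iff)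
  then show ?thesis ..
qed

lemma diophantine_flow_separation:
  fixes \<beta> :: "real ^ 'r::finite"
  assumes dio: "diophantine_flow \<gamma> \<tau> \<beta>" and "\<gamma> > 0" "\<tau> > 0"
  shows "\<exists>c>0. \<forall>n::nat. \<forall>q :: int ^ 'r. n \<ge> 1 \<longrightarrow> q \<noteq> 0 \<longrightarrow> (\<forall>j. \<bar>q $ j\<bar> \<le> 2 * int n) \<longrightarrow>
    \<bar>real_vec q \<bullet> \<beta>\<bar> \<ge> c * real n powr - \<tau>"
proof -
  let ?r = "real CARD('r)"
  \<comment> \<open>For \<open>\<beta> = 0\<close> the normalized direction is 0 as well, because
    \<open>inverse 0 = 0\<close>; the Diophantine bound at the all-ones vector then fails.\<close>
  have \<beta>: "\<beta> \<noteq> 0"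
  proof
    assume 0: "\<beta> = 0"
    define q where "q = (1 :: int ^ 'r)"
    have nz: "real_vec q \<noteq> 0" and "q \<noteq> 0" by (simp_all add: q_def real_vec_def vec_eq_iff)
    then have "\<bar>real_vec q \<bullet> (\<beta> /\<^sub>R norm \<beta>)\<bar> \<ge> \<gamma> * norm (real_vec q) powr - \<tau>"
      using dio unfolding diophantine_flow_def by blast
    then have "\<gamma> * norm (real_vec q) powr - \<tau> \<le> 0" using 0 by simp
    with nz \<open>\<gamma> > 0\<close> show False by (simp add: mult_le_0_iff)
  qed
  \<comment> \<open>The factor \<open>norm \<beta>\<close> undoes the normalization of the
    direction; the last factor comes from the norm bound \<open>2 * r * n\<close> for an integer
    vector with \<open>r\<close> entries of size at most \<open>2 * n\<close>.\<close>
  define c where "c = norm \<beta> * \<gamma> * (2 * ?r) powr - \<tau>"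
  have "c > 0" using \<beta> \<open>\<gamma> > 0\<close> by (simp add: c_def)
  moreover have "\<bar>real_vec q \<bullet> \<beta>\<bar> \<ge> c * real n powr - \<tau>"
    if n: "n \<ge> 1" and q: "q \<noteq> 0" "\<forall>j. \<bar>q $ j\<bar> \<le> 2 * int n" for n :: nat and q :: "int ^ 'r"
  proof -
    have "norm (real_vec q) \<le> (\<Sum>j\<in>UNIV. \<bar>real_vec q $ j\<bar>)" by (rule norm_le_l1_cart)
    also have "\<dots> \<le> (\<Sum>j\<in>(UNIV :: 'r set). 2 * real n)"
    proof (rule sum_mono)
      fix j
      have "real_of_int \<bar>q $ j\<bar> \<le> real_of_int (2 * int n)" using q(2) by (simp only: of_int_le_iff)
      then show "\<bar>real_vec q $ j\<bar> \<le> 2 * real n" by (simp add: real_vec_def)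
    qed
    finally have le: "norm (real_vec q) \<le> (2 * ?r) * real n" by simp
    have "real_vec q \<noteq> 0" using q(1) by (simp add: real_vec_def vec_eq_iff)
    then have "((2 * ?r) * real n) powr - \<tau> \<le> norm (real_vec q) powr - \<tau>"
      using le \<open>\<tau> > 0\<close> by (intro powr_mono2') auto
    then have "\<gamma> * ((2 * ?r) powr - \<tau> * real n powr - \<tau>) \<le> \<gamma> * norm (real_vec q) powr - \<tau>"
      using \<open>\<gamma> > 0\<close> by (intro mult_left_mono) (simp_all add: powr_mult)
    also have "\<dots> \<le> \<bar>real_vec q \<bullet> (\<beta> /\<^sub>R norm \<beta>)\<bar>"
      using dio q(1) by (simp add: diophantine_flow_def)
    also have "\<dots> = \<bar>real_vec q \<bullet> \<beta>\<bar> / norm \<beta>"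
      by (simp add: abs_mult divide_inverse mult.commute)
    finally show ?thesis using \<beta> by (simp add: c_def pos_le_divide_eq mult_ac)
  qed
  ultimately show ?thesis by blast
qed

text \<open>In the coordinates of \<open>\<Xi>\<close> each edge phase is an integer character,
  given by a row of \<open>M\<close>. Characters are Lipschitz, so a visit to a preimage of
  \<open>\<theta>\<close> in the standard torus becomes a visit to \<open>\<theta>\<close> at the
  same rate.\<close>

lemma intrinsic_flow_visits:
  fixes len :: "real ^ 'e::finite" and \<Xi> :: "angle ^ 'r::finite \<Rightarrow> angle ^ 'e"
  assumes \<theta>: "\<theta> \<in> H_torus len" and coords: "intrinsic_coordinates len \<Xi> \<beta>"
    and dio: "diophantine_flow \<gamma> \<tau> \<beta>" "\<gamma> > 0" "\<tau> > 0"
  shows "\<exists>c>0. \<exists>W>0. \<forall>n\<ge>1. \<exists>t. c * real n powr \<tau> \<le> t \<and> t \<le> 3 * (c * real n powr \<tau>) \<and>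
    (\<forall>e. cmod (cis (t * len $ e) - cis_angle (\<theta> $ e)) \<le> W / real n)"
proof -
  obtain M :: "int ^ 'r ^ 'e" where M: "\<And>x. \<Xi> (torus_proj x) = torus_proj (\<chi> e. real_vec (M $ e) \<bullet> x)"
    and flow: "\<And>t. \<Xi> (torus_proj (t *\<^sub>R \<beta>)) = torus_proj (t *\<^sub>R len)"
    and surj: "\<exists>\<Xi>'. homeomorphism UNIV (H_torus len) \<Xi> \<Xi>'"
    using coords unfolding intrinsic_coordinates_def by blast
  obtain y where "\<Xi> y = \<theta>" using surj \<theta> unfolding homeomorphism_def by blast
  then obtain x where x: "\<Xi> (torus_proj x) = \<theta>" using torus_proj_surj by metis
  have \<theta>x: "cis_angle (\<theta> $ e) = cis (real_vec (M $ e) \<bullet> x)" for e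
    unfolding x[symmetric] M by (simp add: torus_proj_def cis_angle_ang)
  have lent: "cis (t * len $ e) = cis (real_vec (M $ e) \<bullet> (t *\<^sub>R \<beta>))" for t e
  proof -
    have "cis_angle (torus_proj (t *\<^sub>R len) $ e) = cis_angle (torus_proj (\<chi> e. real_vec (M $ e) \<bullet> (t *\<^sub>R \<beta>)) $ e)"
      using flow[of t] M[of "t *\<^sub>R \<beta>"] by simp
    then show ?thesis by (simp add: torus_proj_def cis_angle_ang)
  qed
  obtain c where c: "c > 0" and sep: "\<And>n q. n \<ge> 1 \<Longrightarrow> q \<noteq> 0 \<Longrightarrow> (\<And>j. \<bar>q $ j\<bar> \<le> 2 * int n) \<Longrightarrow>
      \<bar>real_vec q \<bullet> \<beta>\<bar> \<ge> c * real n powr - \<tau>"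
    using diophantine_flow_separation[OF dio] by blast
  let ?r = "real CARD('r)"
  define N where "N = (\<Sum>e\<in>UNIV. \<Sum>j\<in>UNIV. real_of_int \<bar>M $ e $ j\<bar>)"
  define W where "W = (1 + N) * sqrt (24 * ?r)"
  have N: "N \<ge> 0" "(\<Sum>j\<in>UNIV. real_of_int \<bar>M $ e $ j\<bar>) \<le> N" for e
    unfolding N_def by (intro sum_nonneg, simp) (rule member_le_sum, auto intro: sum_nonneg)
  have "W > 0" using N by (simp add: W_def)
  moreover have "6 / c > 0" using c by simp
  moreover have "\<exists>t. 6 / c * real n powr \<tau> \<le> t \<and> t \<le> 3 * (6 / c * real n powr \<tau>) \<and>
    (\<forall>e. cmod (cis (t * len $ e) - cis_angle (\<theta> $ e)) \<le> W / real n)" if n: "n \<ge> 1" for n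
  proof -
    \<comment> \<open>This is the radius of the time window for degree \<open>n\<close>. Centring
      the window at \<open>2 * T\<close> confines the time to [T, 3T]: the upper end yields the rate
      in terms of k, the lower end makes the frequencies unbounded.\<close>
    define T where "T = 6 / c * real n powr \<tau>"
    have T: "6 / (c * real n powr - \<tau>) = T"
      by (simp add: T_def powr_minus divide_inverse)
    have "c * real n powr - \<tau> > 0" using c n by simp
    then obtain t where t: "\<bar>t - 2 * T\<bar> \<le> T"
      "(\<Sum>j\<in>UNIV. (cmod (1 - cis (t * \<beta> $ j - x $ j)))\<^sup>2) < 24 * ?r / (real n)\<^sup>2"
      using linear_flow_visits[OF n _ sep[OF n], where m="2 * T" and x=x] unfolding T by blast
    have each: "cmod (1 - cis ((t *\<^sub>R \<beta>) $ j - x $ j)) \<le> sqrt (24 * ?r) / real n" for j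
    proof (rule power2_le_imp_le)
      have "(cmod (1 - cis ((t *\<^sub>R \<beta>) $ j - x $ j)))\<^sup>2 \<le> (\<Sum>j\<in>UNIV. (cmod (1 - cis ((t *\<^sub>R \<beta>) $ j - x $ j)))\<^sup>2)"
        by (rule member_le_sum) auto
      then show "(cmod (1 - cis ((t *\<^sub>R \<beta>) $ j - x $ j)))\<^sup>2 \<le> (sqrt (24 * ?r) / real n)\<^sup>2"
        using t(2) by (simp add: power_divide)
    qed simp
    have "cmod (cis (t * len $ e) - cis_angle (\<theta> $ e)) \<le> W / real n" for e
    proof -
      have "cmod (cis (t * len $ e) - cis_angle (\<theta> $ e)) \<le>
          (\<Sum>j\<in>UNIV. \<bar>real_of_int (M $ e $ j)\<bar>) * (sqrt (24 * ?r) / real n)"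
        unfolding lent \<theta>x by (rule cis_character_lipschitz[OF each])
      also have "\<dots> \<le> (1 + N) * (sqrt (24 * ?r) / real n)"
        using N(2)[of e] by (intro mult_right_mono) auto
      finally show ?thesis by (simp add: W_def)
    qed
    with t(1) show ?thesis by (intro exI[of _ t]) (auto simp: T_def abs_le_iff)
  qed
  ultimately show ?thesis by blast
qed

section \<open>From a point of \<open>R_K\<close> to normalized eigenfunctions\<close>

lemma R_K_simple_fixed_vector:
  fixes G :: "('v::finite, 'e::finite) qgraph"
  assumes "\<theta> \<in> R_K G K"
  shows "\<exists>v. simple_fixed_vector (U_B G \<theta>) v \<and> (\<forall>e. e \<notin> K \<longrightarrow> edge_intensity v e = 0)"
proof -
  let ?E = "{a. U_B G \<theta> *v a = a}"
  obtain a where a: "a \<noteq> 0" "U_B G \<theta> *v a = a" "\<forall>e. edge_intensity a e > 0 \<longleftrightarrow> e \<in> K"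
    and dim: "vec.dim ?E = 1"
    using assms by (auto simp: R_K_def)
  define v where "v = of_real (inverse (norm a)) *s a"
  have nv: "norm v = 1" using a(1) by (simp add: v_def norm_scale_vec norm_inverse)
  then have v0: "v \<noteq> 0" by auto
  have vE: "U_B G \<theta> *v v = v" using a(2) by (simp add: v_def vector_scalar_commute)
  have sub: "vec.subspace ?E"
    by (rule vec.subspaceI) (auto simp: matrix_vector_right_distrib vector_scalar_commute)
  have "vec.span {v} = ?E"
  proof (rule vec.subspace_dim_equal)
    show "vec.span {v} \<subseteq> ?E" using vE by (intro vec.span_minimal sub) auto
    have "vec.dim (vec.span {v}) = 1"
      using v0 by (simp add: vec.dim_eq_card_independent)
    then show "vec.dim ?E \<le> vec.dim (vec.span {v})" using dim by simp
  qed (auto simp: sub)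
  then have "\<exists>c. b = c *s v" if "U_B G \<theta> *v b = b" for b
    using that by (auto simp: vec.span_singleton)
  then have "simple_fixed_vector (U_B G \<theta>) v"
    by unfold_locales (auto simp: norm_U_B nv vE)
  moreover have "edge_intensity v e = 0" if "e \<notin> K" for e
  proof -
    have "edge_intensity a e = 0"
      using a(3) that by (metis edge_intensity_def less_eq_real_def sum_power2_ge_zero)
    then show ?thesis
      by (simp add: edge_intensity_def v_def sum_power2_eq_zero_iff)
  qed
  ultimately show ?thesis by blast
qed

text \<open>The phases at time \<open>t\<close> differ from those of \<open>\<theta>\<close> by the
  ratio \<open>w\<close>. As \<open>U_B G \<theta>\<close> already carries the phases of
  \<open>\<theta>\<close>, multiplying by \<open>w\<close> and by the drift over a time
  \<open>s\<close> gives exactly the bond matrix at \<open>t + s\<close>; the drift speeds are the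
  edge lengths.\<close>

lemma near_resonance:
  fixes G :: "('v::finite, 'e::finite) qgraph"
  assumes v: "simple_fixed_vector (U_B G \<theta>) v" and len: "\<forall>e. len $ e > 0"
  shows "\<exists>C>0. \<exists>\<epsilon>0>0. \<forall>\<epsilon> t. 0 < \<epsilon> \<and> \<epsilon> \<le> \<epsilon>0 \<and> (\<forall>e. cmod (cis (t * len $ e) - cis_angle (\<theta> $ e)) \<le> \<epsilon>) \<longrightarrow>
    (\<exists>k a. \<bar>k - t\<bar> \<le> C * \<epsilon> \<and> norm (a - v) \<le> C * \<epsilon> \<and> U_B G (torus_proj (k *\<^sub>R len)) *v a = a)"
proof -
  interpret simple_fixed_vector "U_B G \<theta>" v by (rule v)
  let ?lam = "\<chi> b :: 'e bond. len $ fst b"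
  obtain C \<epsilon>0 where C: "C > 0" "\<epsilon>0 > 0"
    and pert: "\<And>\<epsilon> w. 0 < \<epsilon> \<Longrightarrow> \<epsilon> \<le> \<epsilon>0 \<Longrightarrow> (\<forall>b. cmod (w $ b) = 1 \<and> cmod (w $ b - 1) \<le> \<epsilon>) \<Longrightarrow>
      \<exists>s a. \<bar>s\<bar> \<le> C * \<epsilon> \<and> norm (a - v) \<le> C * \<epsilon> \<and> phase (\<chi> b. w $ b * cis (s * ?lam $ b)) (U_B G \<theta> *v a) = a"
    using perturbation[of ?lam] len by auto
  have "\<exists>k a. \<bar>k - t\<bar> \<le> C * \<epsilon> \<and> norm (a - v) \<le> C * \<epsilon> \<and> U_B G (torus_proj (k *\<^sub>R len)) *v a = a"
    if \<epsilon>: "0 < \<epsilon>" "\<epsilon> \<le> \<epsilon>0" "\<forall>e. cmod (cis (t * len $ e) - cis_angle (\<theta> $ e)) \<le> \<epsilon>" for \<epsilon> t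
  proof -
    define w where "w = (\<chi> b :: 'e bond. cis (t * len $ fst b) * cnj (cis_angle (\<theta> $ fst b)))"
    have unim: "cmod (cis_angle y) = 1" "cnj (cis_angle y) * cis_angle y = 1" "cis_angle y * cnj (cis_angle y) = 1" for y
      by (transfer, simp, transfer, simp add: cis_cnj cis_mult, transfer, simp add: cis_cnj cis_mult)
    have "cmod (w $ b - 1) \<le> \<epsilon>" for b
    proof -
      have "w $ b - 1 = (cis (t * len $ fst b) - cis_angle (\<theta> $ fst b)) * cnj (cis_angle (\<theta> $ fst b))"
        by (simp only: w_def vec_lambda_beta left_diff_distrib unim)
      then show ?thesis using \<epsilon>(3) by (simp add: norm_mult unim)
    qed
    moreover have "cmod (w $ b) = 1" for b by (simp add: w_def norm_mult unim)
    ultimately obtain s a where s: "\<bar>s\<bar> \<le> C * \<epsilon>" "norm (a - v) \<le> C * \<epsilon>"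
      "phase (\<chi> b. w $ b * cis (s * ?lam $ b)) (U_B G \<theta> *v a) = a"
      using pert[OF \<epsilon>(1,2), of w] by blast
    have "cis (t * len $ fst b) * cnj (cis_angle (\<theta> $ fst b)) * cis (s * len $ fst b) * cis_angle (\<theta> $ fst b)
       = cis ((t + s) * len $ fst b)" for b :: "'e bond"
    proof -
      have "cis (t * len $ fst b) * cnj (cis_angle (\<theta> $ fst b)) * cis (s * len $ fst b) * cis_angle (\<theta> $ fst b)
        = (cnj (cis_angle (\<theta> $ fst b)) * cis_angle (\<theta> $ fst b)) * (cis (t * len $ fst b) * cis (s * len $ fst b))"
        by (simp only: mult_ac)
      then show ?thesis by (simp add: unim cis_mult distrib_right)
    qed
    then have "phase (\<chi> b. w $ b * cis (s * ?lam $ b)) (U_B G \<theta> *v a) = U_B G (torus_proj ((t + s) *\<^sub>R len)) *v a"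
      by (simp add: U_B_apply phase_def w_def vec_eq_iff torus_proj_def cis_angle_ang mult.assoc[symmetric])
    with s show ?thesis by (intro exI[of _ "t + s"] exI[of _ a]) simp
  qed
  with C show ?thesis by blast
qed

lemma edge_wave_scale: "edge_wave len k (c *s a) e x = c * edge_wave len k a e x"
  by (simp add: edge_wave_def algebra_simps)

lemma L2_norm_on_scale: "L2_norm_on len A (\<lambda>e x. c * u e x) = cmod c * L2_norm_on len A u"
  by (simp add: L2_norm_on_def norm_mult power_mult_distrib sum_distrib_left[symmetric] real_sqrt_mult)

lemma L2_norm_on_sq:
  "(L2_norm_on len A u)\<^sup>2 = (\<Sum>e\<in>A. LINT x|lebesgue_on {0..len $ e}. (cmod (u e x))\<^sup>2)"
  by (simp add: L2_norm_on_def sum_nonneg)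

text \<open>Off \<open>K\<close> the amplitudes of \<open>a\<close> are those of
  \<open>a - v\<close>, so the energy there is quadratic in \<open>d\<close>. The bound on
  \<open>k\<close> makes interference at most half of the main term, so energy and intensity are
  comparable on each edge.\<close>

lemma normalized_eigenfunction:
  fixes G :: "('v::finite, 'e::finite) qgraph"
  assumes "lmin > 0" and len: "\<And>e. lmin \<le> len $ e" "\<And>e. len $ e \<le> lmax"
    and k: "k \<ge> 2 / lmin" and a: "U_B G (torus_proj (k *\<^sub>R len)) *v a = a"
    and v: "norm v = 1" "\<And>e. e \<notin> K \<Longrightarrow> edge_intensity v e = 0"
    and close: "norm (a - v) \<le> d" "d \<le> 1 / 2"
  shows "\<exists>u. L2_norm_on len UNIV u = 1 \<and>
    neg_laplacian G len u (\<lambda>e x. of_real (k\<^sup>2) * u e x) \<and>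
    (L2_norm_on len (- K) u)\<^sup>2 \<le> 16 * lmax / lmin * d\<^sup>2"
proof -
  have kpos: "k > 0" using k \<open>lmin > 0\<close> by (smt (verit) divide_pos_pos)
  have lpos: "\<forall>e. len $ e > 0" using len(1) \<open>lmin > 0\<close> less_le_trans by blast
  have lmax: "lmax > 0" using lpos len(2) less_le_trans by blast
  have "1 / k \<le> lmin / 2" using k kpos \<open>lmin > 0\<close> by (simp add: field_simps)
  define J where "J e = (LINT x|lebesgue_on {0..len $ e}. (cmod (edge_wave len k a e x))\<^sup>2)" for e
  have I0: "edge_intensity b e \<ge> 0" for b :: "complex ^ 'e bond" and e by (simp add: edge_intensity_def)
  have J: "lmin / 2 * edge_intensity a e \<le> J e" "J e \<le> 2 * lmax * edge_intensity a e" for e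
  proof -
    have "edge_intensity a e / k \<le> lmin / 2 * edge_intensity a e"
      using mult_right_mono[OF \<open>1 / k \<le> lmin / 2\<close> I0[of a e]] by simp
    moreover have "lmin * edge_intensity a e \<le> len $ e * edge_intensity a e"
      "len $ e * edge_intensity a e \<le> lmax * edge_intensity a e"
      using len I0 by (auto intro: mult_right_mono)
    moreover have "\<bar>J e - len $ e * edge_intensity a e\<bar> \<le> edge_intensity a e / k"
      unfolding J_def using lpos kpos by (intro edge_wave_norm) auto
    ultimately show "lmin / 2 * edge_intensity a e \<le> J e" "J e \<le> 2 * lmax * edge_intensity a e"
      by linarith+
  qed
  define N where "N = L2_norm_on len UNIV (edge_wave len k a)"
  have "norm v \<le> norm a + norm (a - v)" by (metis norm_minus_commute norm_triangle_sub)
  \<comment> \<open>The squared norm of the wave is thus at least \<open>lmin / 2\<close> times 1/4;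
    this eighth and the factor 2 in the upper bound for \<open>J\<close> make up the constant
    16.\<close>
  then have "norm a \<ge> 1 / 2" using v(1) close by linarith
  then have "(norm a)\<^sup>2 \<ge> (1 / 2)\<^sup>2" by (intro power_mono) auto
  then have "lmin / 8 \<le> lmin / 2 * (norm a)\<^sup>2" using \<open>lmin > 0\<close> by (simp add: power_divide)
  also have "\<dots> = (\<Sum>e\<in>UNIV. lmin / 2 * edge_intensity a e)"
    by (simp only: sum_edge_intensity[symmetric] sum_distrib_left)
  also have "\<dots> \<le> (\<Sum>e\<in>UNIV. J e)" by (intro sum_mono J)
  also have "\<dots> = N\<^sup>2" by (simp add: N_def L2_norm_on_sq J_def)
  finally have N2: "N\<^sup>2 \<ge> lmin / 8" .
  have "N \<ge> 0" by (simp add: N_def L2_norm_on_def sum_nonneg)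
  then have N: "N > 0" using N2 \<open>lmin > 0\<close> by (smt (verit) divide_pos_pos zero_power2)
  have "(L2_norm_on len (- K) (edge_wave len k a))\<^sup>2 \<le> (\<Sum>e\<in>- K. 2 * lmax * edge_intensity a e)"
    unfolding L2_norm_on_sq J_def[symmetric] by (intro sum_mono J)
  also have "\<dots> = (\<Sum>e\<in>- K. 2 * lmax * edge_intensity (a - v) e)"
  proof (rule sum.cong[OF refl])
    fix e assume "e \<in> - K"
    then have "edge_intensity v e = 0" using v(2) by simp
    then have "v $ (e, True) = 0" "v $ (e, False) = 0" by (auto simp: edge_intensity_def sum_power2_eq_zero_iff)
    then show "2 * lmax * edge_intensity a e = 2 * lmax * edge_intensity (a - v) e"
      by (simp add: edge_intensity_def)
  qed
  also have "\<dots> \<le> (\<Sum>e\<in>UNIV. 2 * lmax * edge_intensity (a - v) e)"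
    using lmax I0 by (intro sum_mono2) auto
  also have "\<dots> = 2 * lmax * (norm (a - v))\<^sup>2"
    by (simp only: sum_edge_intensity[symmetric] sum_distrib_left)
  also have "\<dots> \<le> 2 * lmax * d\<^sup>2"
    using lmax close by (intro mult_left_mono power_mono) auto
  finally have off: "(L2_norm_on len (- K) (edge_wave len k a))\<^sup>2 \<le> 2 * lmax * d\<^sup>2" .
  define c where "c = complex_of_real (1 / N)"
  define u where "u = edge_wave len k (c *s a)"
  have u: "u = (\<lambda>e x. c * edge_wave len k a e x)" by (simp add: u_def edge_wave_scale fun_eq_iff)
  have cN: "cmod c = 1 / N" using N by (simp add: c_def norm_divide)
  have "L2_norm_on len UNIV u = 1"
    unfolding u L2_norm_on_scale N_def[symmetric] cN using N by simp
  moreover have "neg_laplacian G len u (\<lambda>e x. of_real (k\<^sup>2) * u e x)"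
    unfolding u_def by (rule edge_wave_neg_laplacian[OF lpos]) (simp add: vector_scalar_commute a)
  moreover have "(L2_norm_on len (- K) u)\<^sup>2 \<le> 16 * lmax / lmin * d\<^sup>2"
  proof -
    have "(L2_norm_on len (- K) u)\<^sup>2 = (L2_norm_on len (- K) (edge_wave len k a))\<^sup>2 / N\<^sup>2"
      unfolding u L2_norm_on_scale cN by (simp add: power_divide)
    also have "\<dots> \<le> (2 * lmax * d\<^sup>2) / (lmin / 8)"
      using off N2 \<open>lmin > 0\<close> lmax by (intro frac_le) auto
    finally show ?thesis by (simp add: field_simps)
  qed
  ultimately show ?thesis by blast
qed

theorem theorem6p4:
  fixes G :: "('v::finite, 'e::finite) qgraph"
    and len :: "real ^ 'e"
    and K :: "'e set"
    and \<Xi> :: "angle ^ 'r::finite \<Rightarrow> angle ^ 'e"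
    and \<beta> :: "real ^ 'r"
    and \<gamma> \<tau> :: real
  assumes "connected_graph G"
    and "\<forall>e. len $ e > 0"
    and "primitive_subgraph G K" and "K \<noteq> UNIV"
    and "RAC G K len"
    and "torus_dim len \<ge> 2"
    and "intrinsic_coordinates len \<Xi> \<beta>"
    and "\<gamma> > 0" and "\<tau> > real (torus_dim len) - 1"
    and "diophantine_flow \<gamma> \<tau> \<beta>"
  shows "\<exists>C > 0. \<exists>(k :: nat \<Rightarrow> real) (u :: nat \<Rightarrow> 'e \<Rightarrow> real \<Rightarrow> complex).
    filterlim k at_top sequentially \<and>
    (\<forall>n. k n > 0 \<and>
         L2_norm_on len UNIV (u n) = 1 \<and>
         neg_laplacian G len (u n) (\<lambda>e x. of_real ((k n)\<^sup>2) * u n e x) \<and>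
         (L2_norm_on len (- K) (u n))\<^sup>2 \<le> C * k n powr (- 2 / \<tau>))"
proof -
  \<comment> \<open>Dimension at least 2 enters here: n^\<tau> dominates n, which drives the
    frequencies to infinity.\<close>
  have \<tau>: "\<tau> \<ge> 1" using assms(6,9) by linarith
  have lpos: "\<forall>e. len $ e > 0" by (rule assms(2))
  obtain \<theta> where \<theta>: "\<theta> \<in> H_torus len" "\<theta> \<in> R_K G K"
    using assms(5) by (auto simp: RAC_def)
  obtain v where v: "simple_fixed_vector (U_B G \<theta>) v" and off: "\<And>e. e \<notin> K \<Longrightarrow> edge_intensity v e = 0"
    using R_K_simple_fixed_vector[OF \<theta>(2)] by blast
  have nv: "norm v = 1" using v by (simp add: simple_fixed_vector_def)
  obtain c W where c: "c > 0" and W: "W > 0"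
    and visit: "\<And>n. n \<ge> 1 \<Longrightarrow> \<exists>t. c * real n powr \<tau> \<le> t \<and> t \<le> 3 * (c * real n powr \<tau>) \<and>
      (\<forall>e. cmod (cis (t * len $ e) - cis_angle (\<theta> $ e)) \<le> W / real n)"
    using intrinsic_flow_visits[OF \<theta>(1) assms(7,10,8)] \<tau> by auto
  obtain C \<epsilon>0 where C: "C > 0" "\<epsilon>0 > 0"
    and near: "\<And>\<epsilon> t. 0 < \<epsilon> \<Longrightarrow> \<epsilon> \<le> \<epsilon>0 \<Longrightarrow> \<forall>e. cmod (cis (t * len $ e) - cis_angle (\<theta> $ e)) \<le> \<epsilon> \<Longrightarrow>
      \<exists>k a. \<bar>k - t\<bar> \<le> C * \<epsilon> \<and> norm (a - v) \<le> C * \<epsilon> \<and> U_B G (torus_proj (k *\<^sub>R len)) *v a = a"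
    using near_resonance[OF v lpos] by blast
  define lmin where "lmin = Min (range (($) len))"
  define lmax where "lmax = Max (range (($) len))"
  have len: "lmin > 0" "\<And>e. lmin \<le> len $ e" "\<And>e. len $ e \<le> lmax"
    unfolding lmin_def lmax_def using lpos by auto
  have lmax: "lmax > 0" using lpos len(3) less_le_trans by blast
  \<comment> \<open>The frequency will be at most \<open>4 * c * n powr \<tau>\<close>, so n^-2 is
    at most (4c)^(2/\<tau>) k^(-2/\<tau>). The other factors are those of
    \<open>normalized_eigenfunction\<close> at \<open>d = C * W / n\<close>.\<close>
  define D where "D = 16 * lmax / lmin * (C * W)\<^sup>2 * (4 * c) powr (2 / \<tau>)"
  have D: "D > 0" using lmax len(1) C W c by (simp add: D_def)
  \<comment> \<open>After \<open>n \<ge> 1\<close>, the thresholds give in turn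
    \<open>\<epsilon> \<le> \<epsilon>0\<close>, a correction \<open>C * \<epsilon>\<close> of at
    most 1/2, \<open>c * n \<ge> 1\<close> so that this correction is absorbed (3 becomes 4 above, 1
    becomes 1/2 below), and \<open>k \<ge> 2 / lmin\<close>.\<close>
  have step: "\<exists>k u. k \<ge> c / 2 * real n \<and> k > 0 \<and> L2_norm_on len UNIV u = 1 \<and>
      neg_laplacian G len u (\<lambda>e x. of_real (k\<^sup>2) * u e x) \<and>
      (L2_norm_on len (- K) u)\<^sup>2 \<le> D * k powr (- 2 / \<tau>)"
    if n: "n \<ge> 1" "W / \<epsilon>0 \<le> real n" "2 * C * W \<le> real n" "1 / c \<le> real n" "4 / (c * lmin) \<le> real n" for n :: nat
  proof -
    define \<epsilon> where "\<epsilon> = W / real n"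
    have \<epsilon>: "\<epsilon> > 0" "\<epsilon> \<le> \<epsilon>0" "C * \<epsilon> \<le> 1 / 2"
      using n W C by (auto simp: \<epsilon>_def field_simps)
    obtain t where t: "c * real n powr \<tau> \<le> t" "t \<le> 3 * (c * real n powr \<tau>)"
      "\<forall>e. cmod (cis (t * len $ e) - cis_angle (\<theta> $ e)) \<le> \<epsilon>"
      using visit[OF n(1)] by (auto simp: \<epsilon>_def)
    obtain k a where k: "\<bar>k - t\<bar> \<le> C * \<epsilon>" "norm (a - v) \<le> C * \<epsilon>" "U_B G (torus_proj (k *\<^sub>R len)) *v a = a"
      using near[OF \<epsilon>(1,2) t(3)] by blast
    have "real n powr 1 \<le> real n powr \<tau>" using n(1) \<tau> by (intro powr_mono) auto
    then have "c * real n \<le> c * real n powr \<tau>" using c n(1) by simp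
    moreover have "1 \<le> c * real n" using n(4) c by (simp add: field_simps)
    ultimately have kb: "k \<ge> c / 2 * real n" "k \<le> 4 * (c * real n powr \<tau>)"
      using k(1) \<epsilon>(3) t by (auto simp: abs_le_iff)
    have "c * real n > 0" using c n(1) by simp
    then have kpos: "k > 0" using kb(1) by linarith
    have "2 / lmin \<le> c / 2 * real n" using n(5) c len(1) by (simp add: field_simps)
    then have "k \<ge> 2 / lmin" using kb(1) by linarith
    then obtain u where u: "L2_norm_on len UNIV u = 1"
      "neg_laplacian G len u (\<lambda>e x. of_real (k\<^sup>2) * u e x)"
      "(L2_norm_on len (- K) u)\<^sup>2 \<le> 16 * lmax / lmin * (C * \<epsilon>)\<^sup>2"
      using normalized_eigenfunction[OF len _ k(3) nv off k(2) \<epsilon>(3)] by blast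
    have "(4 * (c * real n powr \<tau>)) powr (- 2 / \<tau>) \<le> k powr (- 2 / \<tau>)"
      using kb(2) kpos \<tau> by (intro powr_mono2') auto
    moreover have "(4 * (c * real n powr \<tau>)) powr (- 2 / \<tau>) = inverse ((4 * c) powr (2 / \<tau>)) * inverse ((real n)\<^sup>2)"
    proof -
      have "(4 * (c * real n powr \<tau>)) powr (- 2 / \<tau>) = (4 * c) powr (- 2 / \<tau>) * (real n powr \<tau>) powr (- 2 / \<tau>)"
        using c by (simp add: powr_mult[symmetric] mult.assoc)
      also have "(real n powr \<tau>) powr (- 2 / \<tau>) = real n powr (- 2)"
        using \<tau> by (simp add: powr_powr)
      also have "\<dots> = inverse ((real n)\<^sup>2)"
        using n(1) by (simp add: powr_minus powr_numeral)
      finally show ?thesis by (simp add: powr_minus[symmetric])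
    qed
    ultimately have "(4 * c) powr (2 / \<tau>) * (inverse ((4 * c) powr (2 / \<tau>)) * inverse ((real n)\<^sup>2))
        \<le> (4 * c) powr (2 / \<tau>) * k powr (- 2 / \<tau>)"
      by (intro mult_left_mono) auto
    then have inv: "inverse ((real n)\<^sup>2) \<le> (4 * c) powr (2 / \<tau>) * k powr (- 2 / \<tau>)"
      using c by (simp add: mult.assoc[symmetric])
    have "16 * lmax / lmin * (C * \<epsilon>)\<^sup>2 = 16 * lmax / lmin * (C * W)\<^sup>2 * inverse ((real n)\<^sup>2)"
      by (simp add: \<epsilon>_def power_mult_distrib power_divide divide_inverse power_inverse)
    also have "\<dots> \<le> 16 * lmax / lmin * (C * W)\<^sup>2 * ((4 * c) powr (2 / \<tau>) * k powr (- 2 / \<tau>))"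
      using lmax len(1) by (intro mult_left_mono inv) auto
    also have "\<dots> = D * k powr (- 2 / \<tau>)" by (simp add: D_def)
    finally show ?thesis using u kb(1) kpos by (intro exI[of _ k] exI[of _ u]) auto
  qed
  \<comment> \<open>The bounds are claimed for every index, so the sequence starts beyond all
    thresholds.\<close>
  define n0 where "n0 = nat \<lceil>Max {1, W / \<epsilon>0, 2 * C * W, 1 / c, 4 / (c * lmin)}\<rceil>"
  have n0: "x \<le> real (n0 + m)" if "x \<in> {1, W / \<epsilon>0, 2 * C * W, 1 / c, 4 / (c * lmin)}" for x and m :: nat
  proof -
    have "x \<le> Max {1, W / \<epsilon>0, 2 * C * W, 1 / c, 4 / (c * lmin)}" using that by (intro Max_ge) auto
    also have "\<dots> \<le> real n0" unfolding n0_def by (rule real_nat_ceiling_ge)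
    finally show ?thesis by simp
  qed
  have "\<exists>k u. k \<ge> c / 2 * real (n0 + n) \<and> k > 0 \<and> L2_norm_on len UNIV u = 1 \<and>
      neg_laplacian G len u (\<lambda>e x. of_real (k\<^sup>2) * u e x) \<and>
      (L2_norm_on len (- K) u)\<^sup>2 \<le> D * k powr (- 2 / \<tau>)" for n
    using n0[of 1 n] by (intro step n0) auto
  then have "\<exists>f. \<forall>n. fst (f n) \<ge> c / 2 * real (n0 + n) \<and> fst (f n) > 0 \<and> L2_norm_on len UNIV (snd (f n)) = 1 \<and>
      neg_laplacian G len (snd (f n)) (\<lambda>e x. of_real ((fst (f n))\<^sup>2) * snd (f n) e x) \<and>
      (L2_norm_on len (- K) (snd (f n)))\<^sup>2 \<le> D * fst (f n) powr (- 2 / \<tau>)"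
    by (intro choice) simp
  then obtain f where f: "\<And>n. fst (f n) \<ge> c / 2 * real (n0 + n)" "\<And>n. fst (f n) > 0"
      "\<And>n. L2_norm_on len UNIV (snd (f n)) = 1"
      "\<And>n. neg_laplacian G len (snd (f n)) (\<lambda>e x. of_real ((fst (f n))\<^sup>2) * snd (f n) e x)"
      "\<And>n. (L2_norm_on len (- K) (snd (f n)))\<^sup>2 \<le> D * fst (f n) powr (- 2 / \<tau>)"
    by blast
  have "filterlim (\<lambda>n. fst (f n)) at_top sequentially"
  proof (rule filterlim_at_top_mono)
    show "filterlim (\<lambda>n. c / 2 * real n) at_top sequentially"
      using c by (intro filterlim_tendsto_pos_mult_at_top[OF tendsto_const] filterlim_real_sequentially) auto
    have "c / 2 * real n \<le> fst (f n)" for n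
    proof -
      have "c / 2 * real n \<le> c / 2 * real (n0 + n)" using c by (intro mult_left_mono) auto
      with f(1)[of n] show ?thesis by linarith
    qed
    then show "\<forall>\<^sub>F n in sequentially. c / 2 * real n \<le> fst (f n)" by simp
  qed
  then show ?thesis
    using f(2-5) by (intro exI[of _ D] conjI D exI[of _ "\<lambda>n. fst (f n)"] exI[of _ "\<lambda>n. snd (f n)"] allI) 
qed

end
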